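(* Let $I$ be an infinite set and let $Y$ be a finite-dimensional smooth real Banach space. Then the norm of the projective tensor product $c_0(I)\widehat{\otimes}_\pi Y$ is SSD. Indeed, the dual space $(c_0(I)\widehat{\otimes}_\pi Y)^*$ has the $w^*$-Kadec-Klee property.
   Context: All Banach spaces are real. $B_X$ and $S_X$ denote the closed unit ball and unit sphere of $X$. A Banach space is smooth if its norm is Gâteaux differentiable at every point of its unit sphere. $c_0(I)$ is the space of families $(a_i)_{i\in I}$ of reals such that $\{i:|a_i|>\varepsilon\}$ is finite for every $\varepsilon>0$, with the supremum norm. SSD: the norm of $X$ is strongly subdifferentiable (SSD) at $x\in S_X$ if the one-sided limit $\lim_{t\to 0^+}\frac{\|x+th\|-1}{t}$ exists uniformly in $h\in S_X$. The norm of $X$ is SSD if it is SSD at every $x\in S_X$. Projective tensor product: $X\widehat{\otimes}_\pi Y$ is the completion of the algebraic tensor product $X\otimes Y$ under the norm $\|z\|_\pi=\inf\{\sum_{n=1}^k\|x_n\|\|y_n\|: z=\sum_{n=1}^k x_n\otimes y_n\}$. Its dual is isometrically identified with the space $\mathcal L(X,Y^* )$ of bounded linear operators with the operator norm, $T\in\mathcal L(X,Y^* )$ acting by $T(x\otimes y)=T(x)(y)$. $w^*$-Kadec-Klee property: $X^*$ has the $w^*$-Kadec-Klee property if whenever a net $(x_s^* )$ in $S_{X^*}$ converges in the weak-star topology $\sigma(X^*,X)$ to some $x^*\in S_{X^*}$, then $\|x_s^*-x^*\|\to 0$. *)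

theory Defs
  imports "HOL-Analysis.Analysis"
begin

section \<open>The Banach space $c_0(I)$\<close>

text \<open>The index set \<open>I\<close> is rendered as a type \<open>'i\<close>.\<close>

typedef 'i c0 = "{a :: 'i \<Rightarrow> real. \<forall>\<epsilon>>0. finite {i. \<bar>a i\<bar> > \<epsilon>}}"
  morphisms c0_apply Abs_c0
  by (rule exI[of _ "\<lambda>_. 0"]) simp

setup_lifting type_definition_c0

lemma c0_apply_finite: "\<epsilon> > 0 \<Longrightarrow> finite {i. \<bar>c0_apply a i\<bar> > \<epsilon>}"
  using c0_apply[of a] by simp

lemma c0_bdd_above: "bdd_above (range (\<lambda>i. \<bar>c0_apply a i\<bar>))"
proof -
  let ?F = "{i. \<bar>c0_apply a i\<bar> > 1}"
  have "finite ?F" by (rule c0_apply_finite) simp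
  then have le: "\<bar>c0_apply a i\<bar> \<le> (\<Sum>j\<in>?F. \<bar>c0_apply a j\<bar>)" if "i \<in> ?F" for i
    using that by (intro member_le_sum) auto
  have "\<bar>c0_apply a i\<bar> \<le> 1 + (\<Sum>j\<in>?F. \<bar>c0_apply a j\<bar>)" for i
  proof (cases "i \<in> ?F")
    case True
    then show ?thesis using le[of i] by linarith
  next
    case False
    then have "\<bar>c0_apply a i\<bar> \<le> 1" by simp
    moreover have "0 \<le> (\<Sum>j\<in>?F. \<bar>c0_apply a j\<bar>)" by (rule sum_nonneg) simp
    ultimately show ?thesis by linarith
  qed
  then show ?thesis by (rule bdd_aboveI2)
qed

instantiation c0 :: (type) real_vector
begin

lift_definition zero_c0 :: "'a c0" is "\<lambda>_. 0" by simp

lift_definition plus_c0 :: "'a c0 \<Rightarrow> 'a c0 \<Rightarrow> 'a c0" is "\<lambda>a b i. a i + b i"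
proof -
  fix a b :: "'a \<Rightarrow> real" and \<epsilon> :: real
  assume *: "\<And>\<epsilon>. \<epsilon> > 0 \<Longrightarrow> finite {i. \<bar>a i\<bar> > \<epsilon>}"
    "\<And>\<epsilon>. \<epsilon> > 0 \<Longrightarrow> finite {i. \<bar>b i\<bar> > \<epsilon>}" "\<epsilon> > 0"
  have "{i. \<bar>a i + b i\<bar> > \<epsilon>} \<subseteq> {i. \<bar>a i\<bar> > \<epsilon>/2} \<union> {i. \<bar>b i\<bar> > \<epsilon>/2}" by auto
  moreover have "finite ({i. \<bar>a i\<bar> > \<epsilon>/2} \<union> {i. \<bar>b i\<bar> > \<epsilon>/2})" using *(1,2)[of "\<epsilon>/2"] *(3) by (simp del: less_divide_eq_numeral1 divide_less_eq_numeral1)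
  ultimately show "finite {i. \<bar>a i + b i\<bar> > \<epsilon>}" by (rule finite_subset)
qed

lift_definition scaleR_c0 :: "real \<Rightarrow> 'a c0 \<Rightarrow> 'a c0" is "\<lambda>r a i. r * a i"
proof -
  fix r :: real and a :: "'a \<Rightarrow> real" and \<epsilon> :: real
  assume *: "\<And>\<epsilon>. \<epsilon> > 0 \<Longrightarrow> finite {i. \<bar>a i\<bar> > \<epsilon>}" "\<epsilon> > 0"
  show "finite {i. \<bar>r * a i\<bar> > \<epsilon>}"
  proof (cases "r = 0")
    case False
    then have "{i. \<bar>r * a i\<bar> > \<epsilon>} = {i. \<bar>a i\<bar> > \<epsilon> / \<bar>r\<bar>}"
      by (auto simp: abs_mult field_simps)
    then show ?thesis using * False by simp
  qed (use * in simp)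
qed

lift_definition uminus_c0 :: "'a c0 \<Rightarrow> 'a c0" is "\<lambda>a i. - a i" by simp

definition minus_c0 :: "'a c0 \<Rightarrow> 'a c0 \<Rightarrow> 'a c0" where "minus_c0 a b = a + (- b)"

instance
proof
  fix a b c :: "'a c0" and r s :: real
  show "a + b + c = a + (b + c)" by transfer (simp add: add.assoc)
  show "a + b = b + a" by transfer (simp add: add.commute)
  show "0 + a = a" by transfer simp
  show "- a + a = 0" by transfer simp
  show "a - b = a + - b" by (rule minus_c0_def)
  show "r *\<^sub>R (a + b) = r *\<^sub>R a + r *\<^sub>R b" by transfer (simp add: distrib_left)
  show "(r + s) *\<^sub>R a = r *\<^sub>R a + s *\<^sub>R a" by transfer (simp add: distrib_right)
  show "r *\<^sub>R s *\<^sub>R a = (r * s) *\<^sub>R a" by transfer (simp add: mult.assoc)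
  show "1 *\<^sub>R a = a" by transfer simp
qed

end

lemma c0_apply_simps [simp]:
  "c0_apply 0 i = 0"
  "c0_apply (a + b) i = c0_apply a i + c0_apply b i"
  "c0_apply (- a) i = - c0_apply a i"
  "c0_apply (a - b) i = c0_apply a i - c0_apply b i"
  "c0_apply (r *\<^sub>R a) i = r * c0_apply a i"
  by (simp_all add: minus_c0_def zero_c0.rep_eq plus_c0.rep_eq uminus_c0.rep_eq scaleR_c0.rep_eq
      del: add_uminus_conv_diff)

lemma c0_eqI: "(\<And>i. c0_apply a i = c0_apply b i) \<Longrightarrow> a = b"
  by (simp add: c0_apply_inject[symmetric] fun_eq_iff)

instantiation c0 :: (type) real_normed_vector
begin

definition norm_c0 :: "'a c0 \<Rightarrow> real" where "norm_c0 a = (SUP i. \<bar>c0_apply a i\<bar>)"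
definition sgn_c0 :: "'a c0 \<Rightarrow> 'a c0" where "sgn_c0 a = a /\<^sub>R norm a"
definition dist_c0 :: "'a c0 \<Rightarrow> 'a c0 \<Rightarrow> real" where "dist_c0 a b = norm (a - b)"
definition "(uniformity :: ('a c0 \<times> 'a c0) filter) =
  (INF e\<in>{0<..}. principal {(x, y). dist x y < e})"
definition open_c0 :: "'a c0 set \<Rightarrow> bool" where
  "open_c0 S = (\<forall>x\<in>S. \<forall>\<^sub>F (x', y) in uniformity. x' = x \<longrightarrow> y \<in> S)"

lemma c0_apply_le_norm: "\<bar>c0_apply a i\<bar> \<le> norm (a :: 'a c0)"
  unfolding norm_c0_def by (rule cSUP_upper[OF _ c0_bdd_above]) simp

lemma c0_norm_le: "(\<And>i. \<bar>c0_apply a i\<bar> \<le> C) \<Longrightarrow> norm (a :: 'a c0) \<le> C"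
  unfolding norm_c0_def by (rule cSUP_least) auto

instance
proof
  fix a b :: "'a c0" and r :: real and S :: "'a c0 set"
  show "sgn a = a /\<^sub>R norm a" by (rule sgn_c0_def)
  show "dist a b = norm (a - b)" by (rule dist_c0_def)
  show "(uniformity :: ('a c0 \<times> 'a c0) filter) = (INF e\<in>{0<..}. principal {(x, y). dist x y < e})"
    by (rule uniformity_c0_def)
  show "open S \<longleftrightarrow> (\<forall>x\<in>S. \<forall>\<^sub>F (x', y) in uniformity. x' = x \<longrightarrow> y \<in> S)"
    by (rule open_c0_def)
  show "norm a = 0 \<longleftrightarrow> a = 0"
  proof
    assume "norm a = 0"
    then show "a = 0"
      using c0_apply_le_norm[of a] by (intro c0_eqI) (simp)
  qed (simp add: norm_c0_def)
  show "norm (a + b) \<le> norm a + norm b"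
  proof (rule c0_norm_le)
    fix i
    show "\<bar>c0_apply (a + b) i\<bar> \<le> norm a + norm b"
      using c0_apply_le_norm[of a i] c0_apply_le_norm[of b i] by simp
  qed
  have le: "norm (r *\<^sub>R a) \<le> \<bar>r\<bar> * norm a" for r and a :: "'a c0"
    by (rule c0_norm_le) (simp add: abs_mult c0_apply_le_norm mult_left_mono)
  have "\<bar>r\<bar> * norm a \<le> norm (r *\<^sub>R a)"
  proof (cases "r = 0")
    case True
    show ?thesis by (simp add: True norm_c0_def)
  next
    case False
    have "norm a = norm (inverse r *\<^sub>R (r *\<^sub>R a))" using False by simp
    also have "\<dots> \<le> \<bar>inverse r\<bar> * norm (r *\<^sub>R a)" by (rule le)
    finally show ?thesis using False by (simp add: field_simps)
  qed
  then show "norm (r *\<^sub>R a) = \<bar>r\<bar> * norm a" by (rule antisym[OF le])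
qed

end

instance c0 :: (type) banach
proof
  fix X :: "nat \<Rightarrow> 'a c0"
  assume X: "Cauchy X"
  have dist_apply: "dist (c0_apply a i) (c0_apply b i) \<le> dist a b" for a b :: "'a c0" and i
    using c0_apply_le_norm[of "a - b" i] by (simp add: dist_norm)
  have "Cauchy (\<lambda>n. c0_apply (X n) i)" for i
  proof (rule metric_CauchyI)
    fix e :: real assume "e > 0"
    with X obtain N where "\<And>m n. m \<ge> N \<Longrightarrow> n \<ge> N \<Longrightarrow> dist (X m) (X n) < e"
      by (meson metric_CauchyD)
    then show "\<exists>N. \<forall>m\<ge>N. \<forall>n\<ge>N. dist (c0_apply (X m) i) (c0_apply (X n) i) < e"
      using le_less_trans[OF dist_apply] by blast
  qed
  then have "\<forall>i. \<exists>l. (\<lambda>n. c0_apply (X n) i) \<longlonglongrightarrow> l"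
    by (simp add: Cauchy_convergent_iff convergent_def)
  then obtain a where a: "\<And>i. (\<lambda>n. c0_apply (X n) i) \<longlonglongrightarrow> a i"
    by metis
  have unif: "\<exists>N. \<forall>n\<ge>N. \<forall>i. \<bar>c0_apply (X n) i - a i\<bar> \<le> e" if "e > 0" for e
  proof -
    from X \<open>e > 0\<close> obtain N where N: "\<And>m n. m \<ge> N \<Longrightarrow> n \<ge> N \<Longrightarrow> dist (X m) (X n) < e"
      by (meson metric_CauchyD)
    have "\<bar>c0_apply (X n) i - a i\<bar> \<le> e" if "n \<ge> N" for n i
    proof (rule tendsto_upperbound)
      show "(\<lambda>m. \<bar>c0_apply (X n) i - c0_apply (X m) i\<bar>) \<longlonglongrightarrow> \<bar>c0_apply (X n) i - a i\<bar>"
        by (intro tendsto_intros a)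
      show "\<forall>\<^sub>F m in sequentially. \<bar>c0_apply (X n) i - c0_apply (X m) i\<bar> \<le> e"
      proof (rule eventually_sequentiallyI)
        fix m assume "m \<ge> N"
        then show "\<bar>c0_apply (X n) i - c0_apply (X m) i\<bar> \<le> e"
          using N[OF that, of m] dist_apply[of "X n" i "X m"] by (simp add: dist_real_def)
      qed
    qed simp
    then show ?thesis by blast
  qed
  have "finite {i. \<bar>a i\<bar> > e}" if "e > 0" for e
  proof -
    have "e/2 > 0" using \<open>e > 0\<close> by simp
    from unif[OF this] obtain N where N: "\<And>i. \<bar>c0_apply (X N) i - a i\<bar> \<le> e/2"
      by blast
    have "{i. \<bar>a i\<bar> > e} \<subseteq> {i. \<bar>c0_apply (X N) i\<bar> > e/2}"
    proof
      fix i assume "i \<in> {i. \<bar>a i\<bar> > e}"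
      then show "i \<in> {i. \<bar>c0_apply (X N) i\<bar> > e/2}" using N[of i] by (simp add: abs_if split: if_splits)
    qed
    then show ?thesis using c0_apply_finite[OF \<open>e/2 > 0\<close>] by (rule finite_subset)
  qed
  then have app: "c0_apply (Abs_c0 a) = a" by (intro Abs_c0_inverse) auto
  have "X \<longlonglongrightarrow> Abs_c0 a"
  proof (rule metric_LIMSEQ_I)
    fix e :: real assume "e > 0"
    then have "e/2 > 0" by simp
    from unif[OF this] obtain N where N: "\<And>n i. n \<ge> N \<Longrightarrow> \<bar>c0_apply (X n) i - a i\<bar> \<le> e/2"
      by blast
    have "dist (X n) (Abs_c0 a) < e" if "n \<ge> N" for n
    proof -
      have "norm (X n - Abs_c0 a) \<le> e/2" using N[OF that] by (intro c0_norm_le) (simp only: c0_apply_simps app)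
      then show ?thesis using \<open>e > 0\<close> by (simp add: dist_norm)
    qed
    then show "\<exists>N. \<forall>n\<ge>N. dist (X n) (Abs_c0 a) < e" by blast
  qed
  then show "convergent X" by (rule convergentI)
qed


section \<open>Bounded functionals separate points\<close>

text \<open>
  This instance of the Hahn--Banach theorem is needed for the projective tensor norm to be
  definite. The functional is a minimal sublinear functional below a suitable one.
\<close>

definition sublinear :: "('a::real_vector \<Rightarrow> real) \<Rightarrow> bool" where
  "sublinear q \<longleftrightarrow> (\<forall>x y. q (x + y) \<le> q x + q y) \<and> (\<forall>r x. r \<ge> 0 \<longrightarrow> q (r *\<^sub>R x) = r * q x)"

lemma sublinearI:
  assumes "\<And>x y. q (x + y) \<le> q x + q y" and "\<And>r x. r > 0 \<Longrightarrow> q (r *\<^sub>R x) \<le> r * q x" and "q 0 = 0"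
  shows "sublinear q"
proof -
  have "r * q x \<le> q (r *\<^sub>R x)" if "r > 0" for r x
    using assms(2)[of "inverse r" "r *\<^sub>R x"] that by (simp add: field_simps)
  then have "q (r *\<^sub>R x) = r * q x" if "r \<ge> 0" for r x
    using that assms(2,3) by (cases "r = 0") (auto intro: antisym)
  then show ?thesis using assms(1) by (simp add: sublinear_def)
qed

lemma sublinear_0: "sublinear q \<Longrightarrow> q 0 = 0"
  unfolding sublinear_def by (auto dest!: spec[where x = 0])

lemma sublinear_lower: "sublinear q \<Longrightarrow> - q (- x) \<le> q x"
proof -
  assume q: "sublinear q"
  then have "q (x + - x) \<le> q x + q (- x)" unfolding sublinear_def by blast
  then show ?thesis using sublinear_0[OF q] by simp
qed

lemma sublinear_shift:
  fixes q :: "'a::real_vector \<Rightarrow> real" and x y :: 'a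
  assumes q: "sublinear q"
  defines "p \<equiv> \<lambda>x. INF t\<in>{0..}. q (x + t *\<^sub>R y) - t * q y"
  shows "sublinear p" and "p x \<le> q x" and "p x \<le> q (x + y) - q y"
proof -
  have add: "q (u + v) \<le> q u + q v" and hom: "r \<ge> 0 \<Longrightarrow> q (r *\<^sub>R u) = r * q u" for u v r
    using q by (auto simp: sublinear_def)
  have bdd: "bdd_below ((\<lambda>t. q (x + t *\<^sub>R y) - t * q y) ` {0..})" for x
  proof (rule bdd_belowI2)
    fix t :: real assume "t \<in> {0..}"
    then show "- q (- x) \<le> q (x + t *\<^sub>R y) - t * q y"
      using add[of "x + t *\<^sub>R y" "- x"] hom[of t y] by simp
  qed
  have up: "p x \<le> q (x + t *\<^sub>R y) - t * q y" if "t \<ge> 0" for x t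
    unfolding p_def using that by (intro cINF_lower[OF bdd]) auto
  have low: "c \<le> p x" if "\<And>t. t \<ge> 0 \<Longrightarrow> c \<le> q (x + t *\<^sub>R y) - t * q y" for c x
    unfolding p_def using that by (intro cINF_greatest) auto
  show "p x \<le> q x" using up[of 0 x] by simp
  show "p x \<le> q (x + y) - q y" using up[of 1 x] by simp
  show "sublinear p"
  proof (rule sublinearI)
    fix x z
    have "p (x + z) - (q (z + t *\<^sub>R y) - t * q y) \<le> p x" if "t \<ge> 0" for t
    proof (rule low)
      fix s :: real assume "s \<ge> 0"
      have "p (x + z) \<le> q ((x + z) + (s + t) *\<^sub>R y) - (s + t) * q y"
        using \<open>s \<ge> 0\<close> \<open>t \<ge> 0\<close> by (intro up) simp
      moreover have "q ((x + z) + (s + t) *\<^sub>R y) \<le> q (x + s *\<^sub>R y) + q (z + t *\<^sub>R y)"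
        using add[of "x + s *\<^sub>R y" "z + t *\<^sub>R y"] by (simp add: algebra_simps)
      ultimately show "p (x + z) - (q (z + t *\<^sub>R y) - t * q y) \<le> q (x + s *\<^sub>R y) - s * q y"
        by (simp add: algebra_simps)
    qed
    then have "p (x + z) - p x \<le> p z" by (intro low) (simp add: algebra_simps)
    then show "p (x + z) \<le> p x + p z" by simp
  next
    fix r :: real and x assume r: "r > 0"
    have "p (r *\<^sub>R x) / r \<le> p x"
    proof (rule low)
      fix t :: real assume "t \<ge> 0"
      have "p (r *\<^sub>R x) \<le> q (r *\<^sub>R x + (r * t) *\<^sub>R y) - (r * t) * q y"
        using r \<open>t \<ge> 0\<close> by (intro up) simp
      also have "\<dots> = r * (q (x + t *\<^sub>R y) - t * q y)"
        using hom[of r "x + t *\<^sub>R y"] r by (simp add: algebra_simps)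
      finally show "p (r *\<^sub>R x) / r \<le> q (x + t *\<^sub>R y) - t * q y" using r by (simp add: field_simps)
    qed
    then show "p (r *\<^sub>R x) \<le> r * p x" using r by (simp add: field_simps)
  next
    have "0 \<le> p 0" by (rule low) (simp add: hom)
    moreover have "p 0 \<le> 0" using up[of 0 0] sublinear_0[OF q] by simp
    ultimately show "p 0 = 0" by simp
  qed
qed

lemma sublinear_INF_chain:
  fixes C :: "('a::real_vector \<Rightarrow> real) set"
  assumes "C \<noteq> {}" and sub: "\<And>q. q \<in> C \<Longrightarrow> sublinear q \<and> (\<forall>x. q x \<le> p x)"
    and chain: "\<And>q q'. q \<in> C \<Longrightarrow> q' \<in> C \<Longrightarrow> (\<forall>x. q x \<le> q' x) \<or> (\<forall>x. q' x \<le> q x)"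
  defines "u \<equiv> \<lambda>x. INF q\<in>C. q x"
  shows "sublinear u" and "q \<in> C \<Longrightarrow> u x \<le> q x"
proof -
  have bdd: "bdd_below ((\<lambda>q. q x) ` C)" for x
  proof (rule bdd_belowI2)
    fix q assume "q \<in> C"
    then show "- p (- x) \<le> q x"
      using sub[of q] sublinear_lower[of q x] by (meson neg_le_iff_le order_trans)
  qed
  have up: "u x \<le> q x" if "q \<in> C" for q x
    unfolding u_def by (intro cINF_lower[OF bdd] that)
  then show "q \<in> C \<Longrightarrow> u x \<le> q x" .
  have low: "c \<le> u x" if "\<And>q. q \<in> C \<Longrightarrow> c \<le> q x" for c x
    unfolding u_def using that \<open>C \<noteq> {}\<close> by (intro cINF_greatest) auto
  show "sublinear u"
  proof (rule sublinearI)
    fix x y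
    have "u (x + y) - q' y \<le> u x" if "q' \<in> C" for q'
    proof (rule low)
      fix q assume "q \<in> C"
      obtain m where "m \<in> C" "m x \<le> q x" "m y \<le> q' y"
        using chain[OF \<open>q \<in> C\<close> \<open>q' \<in> C\<close>] \<open>q \<in> C\<close> \<open>q' \<in> C\<close> by (metis order_refl)
      moreover have "m (x + y) \<le> m x + m y" using sub[OF \<open>m \<in> C\<close>] by (simp add: sublinear_def)
      ultimately show "u (x + y) - q' y \<le> q x" using up[of m "x + y"] by linarith
    qed
    then have "u (x + y) - u x \<le> u y" by (intro low) (simp add: algebra_simps)
    then show "u (x + y) \<le> u x + u y" by simp
  next
    fix r :: real and x assume r: "r > 0"
    have "u (r *\<^sub>R x) / r \<le> u x"
    proof (rule low)
      fix q assume "q \<in> C"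
      then have "u (r *\<^sub>R x) \<le> r * q x"
        using up[of q "r *\<^sub>R x"] sub[of q] r by (simp add: sublinear_def)
      then show "u (r *\<^sub>R x) / r \<le> q x" using r by (simp add: field_simps)
    qed
    then show "u (r *\<^sub>R x) \<le> r * u x" using r by (simp add: field_simps)
  next
    have "q 0 = 0" if "q \<in> C" for q using sub[OF that] by (simp add: sublinear_0)
    then have "u 0 = (INF q\<in>C. 0)" unfolding u_def by (intro INF_cong) auto
    then show "u 0 = 0" using \<open>C \<noteq> {}\<close> by simp
  qed
qed

lemma sublinear_dominates_linear:
  fixes p :: "'a::real_vector \<Rightarrow> real"
  assumes p: "sublinear p"
  obtains f where "linear f" and "\<And>x. f x \<le> p x"
proof -
  define A where "A = {q. sublinear q \<and> (\<forall>x. q x \<le> p x)}"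
  define P where "P = (\<lambda>q q' :: 'a \<Rightarrow> real. q' \<le> q)"
  have "\<exists>m\<in>A. \<forall>a\<in>A. P m a \<longrightarrow> a = m"
  proof (rule predicate_Zorn)
    show "partial_order_on A (relation_of P A)"
      unfolding P_def by (rule partial_order_on_relation_ofI) auto
    fix C assume C: "C \<in> Chains (relation_of P A)"
    show "\<exists>u\<in>A. \<forall>a\<in>C. P a u"
    proof (cases "C = {}")
      case True
      then show ?thesis using p by (auto simp: A_def)
    next
      case False
      have sub: "sublinear q \<and> (\<forall>x. q x \<le> p x)" if "q \<in> C" for q
        using C that by (auto simp: Chains_def relation_of_def A_def)
      have chain: "(\<forall>x. q x \<le> q' x) \<or> (\<forall>x. q' x \<le> q x)" if "q \<in> C" "q' \<in> C" for q q'
        using C that by (force simp: Chains_def relation_of_def P_def le_fun_def)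
      note * = sublinear_INF_chain[OF False sub chain]
      define u where "u = (\<lambda>x. INF q\<in>C. q x)"
      have "sublinear u" and "\<And>q x. q \<in> C \<Longrightarrow> u x \<le> q x" unfolding u_def using * by blast+
      moreover from this have "u x \<le> p x" for x using False sub by (meson ex_in_conv order_trans)
      ultimately show ?thesis by (intro bexI[of _ u]) (auto simp: A_def P_def le_fun_def)
    qed
  qed
  then obtain f where "f \<in> A" and max: "\<And>q. q \<in> A \<Longrightarrow> P f q \<Longrightarrow> q = f" by blast
  then have f: "sublinear f" "f x \<le> p x" for x by (auto simp: A_def)
  have min: "q = f" if "sublinear q" "\<And>x. q x \<le> f x" for q
  proof (rule max)
    have "q x \<le> p x" for x using that(2)[of x] f(2)[of x] by (rule order_trans)
    then show "q \<in> A" using that(1) by (simp add: A_def)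
    show "P f q" using that(2) by (simp add: P_def le_fun_def)
  qed
  have add: "f (x + y) = f x + f y" for x y
  proof (rule antisym)
    show "f (x + y) \<le> f x + f y" using f(1) by (simp add: sublinear_def)
    have "(\<lambda>x. INF t\<in>{0..}. f (x + t *\<^sub>R y) - t * f y) = f"
      by (intro min sublinear_shift f(1))
    then show "f x + f y \<le> f (x + y)"
      using sublinear_shift(3)[OF f(1), of x y] by (simp add: fun_eq_iff)
  qed
  have hom: "f (r *\<^sub>R x) = r * f x" if "r \<ge> 0" for r x
    using f(1) that unfolding sublinear_def by blast
  have neg: "f (- x) = - f x" for x
    using add[of x "- x"] sublinear_0[OF f(1)] by simp
  have "f (r *\<^sub>R x) = r * f x" for r x
  proof (cases "r \<ge> 0")
    case True
    then show ?thesis by (rule hom)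
  next
    case False
    then have "f ((- r) *\<^sub>R x) = (- r) * f x" by (intro hom) simp
    moreover have "f ((- r) *\<^sub>R x) = - f (r *\<^sub>R x)" using neg[of "r *\<^sub>R x"] by simp
    ultimately show ?thesis by simp
  qed
  with add have "linear f" by (intro linearI) simp_all
  then show ?thesis using f(2) by (rule that)
qed

lemma bounded_linear_separates:
  fixes x :: "'a::real_normed_vector"
  assumes "x \<noteq> 0"
  obtains f :: "'a \<Rightarrow> real" where "bounded_linear f" and "f x \<noteq> 0"
proof -
  have n: "sublinear (norm :: 'a \<Rightarrow> real)" by (simp add: sublinear_def norm_triangle_ineq)
  define p where "p = (\<lambda>z. INF t\<in>{0..}. norm (z + t *\<^sub>R x) - t * norm x)"
  have "sublinear p" unfolding p_def by (rule sublinear_shift(1)[OF n])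
  then obtain f where f: "linear f" "\<And>z. f z \<le> p z"
    using sublinear_dominates_linear by metis
  have pn: "p z \<le> norm z" and px: "p z \<le> norm (z + x) - norm x" for z
    unfolding p_def using sublinear_shift(2,3)[OF n] by blast+
  have "\<bar>f z\<bar> \<le> norm z" for z
    using f(2)[of z] f(2)[of "- z"] pn[of z] pn[of "- z"] linear_neg[OF f(1), of z] by simp
  then have "bounded_linear f"
    using f(1) by (intro bounded_linear_intro[where K=1]) (auto simp: linear_add linear_cmul)
  moreover have "- f x \<le> - norm x"
    using f(2)[of "- x"] px[of "- x"] linear_neg[OF f(1), of x] by simp
  then have "f x \<noteq> 0" using assms by auto
  ultimately show ?thesis by (rule that)
qed


section \<open>The algebraic tensor product\<close>

text \<open>
  An element of \<open>X \<otimes> Y\<close> is represented by a list \<open>[(x\<^sub>1, y\<^sub>1), \<dots>, (x\<^sub>k, y\<^sub>k)]\<close>, standing for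
  \<open>x\<^sub>1 \<otimes> y\<^sub>1 + \<dots> + x\<^sub>k \<otimes> y\<^sub>k\<close>. Two lists are identified iff no bilinear form
  distinguishes them; lemma \<open>tensor_universal\<close> below is the universal property.
\<close>

definition bilin_sum :: "('a \<Rightarrow> 'b \<Rightarrow> 'c) \<Rightarrow> ('a \<times> 'b) list \<Rightarrow> 'c::monoid_add" where
  "bilin_sum B zs = (\<Sum>(x, y)\<leftarrow>zs. B x y)"

definition tensor_rel :: "('a::real_vector \<times> 'b::real_vector) list \<Rightarrow> ('a \<times> 'b) list \<Rightarrow> bool" where
  "tensor_rel zs ws \<longleftrightarrow> (\<forall>B :: 'a \<Rightarrow> 'b \<Rightarrow> real. bilinear B \<longrightarrow> bilin_sum B zs = bilin_sum B ws)"

quotient_type (overloaded) ('a, 'b) tensor = "('a::real_vector \<times> 'b::real_vector) list" / tensor_rel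
  by (auto intro!: equivpI reflpI sympI transpI simp: tensor_rel_def)

lemma bilin_sum_simps [simp]:
  "bilin_sum B [] = 0"
  "bilin_sum B ((x, y) # zs) = B x y + bilin_sum B zs"
  "bilin_sum B (zs @ ws) = bilin_sum B zs + bilin_sum B ws"
  by (simp_all add: bilin_sum_def)

lemma bilin_sum_scale:
  fixes B :: "'a::real_vector \<Rightarrow> 'b::real_vector \<Rightarrow> 'c::real_vector"
  assumes "bilinear B"
  shows "bilin_sum B (map (\<lambda>(x, y). (r *\<^sub>R x, y)) zs) = r *\<^sub>R bilin_sum B zs"
  by (induction zs) (auto simp: bilinear_lmul[OF assms] scaleR_add_right)

instantiation tensor :: (real_vector, real_vector) real_vector
begin

lift_definition zero_tensor :: "('a, 'b) tensor" is "[]" .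

lift_definition plus_tensor :: "('a, 'b) tensor \<Rightarrow> ('a, 'b) tensor \<Rightarrow> ('a, 'b) tensor" is "(@)"
  by (simp add: tensor_rel_def)

lift_definition scaleR_tensor :: "real \<Rightarrow> ('a, 'b) tensor \<Rightarrow> ('a, 'b) tensor"
  is "\<lambda>r. map (\<lambda>(x, y). (r *\<^sub>R x, y))"
  by (simp add: tensor_rel_def bilin_sum_scale)

definition uminus_tensor :: "('a, 'b) tensor \<Rightarrow> ('a, 'b) tensor" where
  "uminus_tensor u = (- 1) *\<^sub>R u"

definition minus_tensor :: "('a, 'b) tensor \<Rightarrow> ('a, 'b) tensor \<Rightarrow> ('a, 'b) tensor" where
  "minus_tensor u v = u + (- v)"

instance
proof
  fix u v w :: "('a, 'b) tensor" and r s :: real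
  show "u + v + w = u + (v + w)" by transfer (simp add: tensor_rel_def)
  show "u + v = v + u" by transfer (simp add: tensor_rel_def)
  show "0 + u = u" by transfer (simp add: tensor_rel_def)
  show "- u + u = 0"
    unfolding uminus_tensor_def
    by transfer (simp add: tensor_rel_def bilin_sum_scale del: scaleR_minus_left scaleR_minus1_left)
  show "u - v = u + - v" by (rule minus_tensor_def)
  show "r *\<^sub>R (u + v) = r *\<^sub>R u + r *\<^sub>R v" by transfer (simp add: tensor_rel_def)
  show "(r + s) *\<^sub>R u = r *\<^sub>R u + s *\<^sub>R u"
    by transfer (simp add: tensor_rel_def bilin_sum_scale distrib_right)
  show "r *\<^sub>R s *\<^sub>R u = (r * s) *\<^sub>R u"
    by transfer (simp add: tensor_rel_def bilin_sum_scale del: map_map)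
  show "1 *\<^sub>R u = u" by transfer (simp add: tensor_rel_def bilin_sum_scale)
qed

end

lift_definition tensor :: "'a::real_vector \<Rightarrow> 'b::real_vector \<Rightarrow> ('a, 'b) tensor"
  is "\<lambda>x y. [(x, y)]" .

lemma abs_tensor_eq: "abs_tensor zs = (\<Sum>(x, y)\<leftarrow>zs. tensor x y)"
proof (induction zs)
  case Nil
  show ?case by (simp add: zero_tensor.abs_eq)
next
  case (Cons z zs)
  obtain x y where "z = (x, y)" by (cases z)
  moreover have "abs_tensor ((x, y) # zs) = tensor x y + abs_tensor zs"
    by (simp add: tensor.abs_eq plus_tensor.abs_eq)
  ultimately show ?case by (simp add: Cons)
qed

lemma tensor_sum_exists: obtains zs where "u = (\<Sum>(x, y)\<leftarrow>zs. tensor x y)"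
  by (metis Quotient3_tensor Quotient3_abs_rep abs_tensor_eq)

lemma tensor_sum_eq_iff:
  "(\<Sum>(x, y)\<leftarrow>zs. tensor x y) = (\<Sum>(x, y)\<leftarrow>ws. tensor x y) \<longleftrightarrow> tensor_rel zs ws"
  unfolding abs_tensor_eq[symmetric] by (rule tensor.abs_eq_iff)

lemma bilinear_tensor: "bilinear tensor"
  unfolding bilinear_def
  by (safe intro!: linearI; transfer)
    (simp_all add: tensor_rel_def bilinear_ladd bilinear_radd bilinear_lmul bilinear_rmul)

lemma tensor_universal:
  fixes h :: "'a::real_vector \<Rightarrow> 'b::real_vector \<Rightarrow> 'c::real_vector"
  assumes h: "bilinear h"
  shows "\<exists>!L. linear L \<and> (\<forall>x y. L (tensor x y) = h x y)"
proof (rule ex_ex1I)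
  have sum_h: "bilin_sum h zs = bilin_sum h ws" if "tensor_rel zs ws" for zs ws
  proof (rule ccontr)
    assume ne: "bilin_sum h zs \<noteq> bilin_sum h ws"
    define w where "w = bilin_sum h zs - bilin_sum h ws"
    have "w \<noteq> 0" using ne by (simp add: w_def)
    then obtain g :: "'c \<Rightarrow> real" where g: "linear g" "g w = 1"
      using linear_independent_extend[of "{w}" "\<lambda>_. 1 :: real"] by auto
    have g_sum: "g (bilin_sum h us) = bilin_sum (\<lambda>x y. g (h x y)) us" for us
      by (induction us) (auto simp: linear_0[OF g(1)] linear_add[OF g(1)])
    have "bilinear (\<lambda>x y. g (h x y))"
      using h g(1) unfolding bilinear_def by (auto intro: linear_compose[unfolded o_def])
    then have "g w = 0"
      using that by (simp add: w_def linear_diff[OF g(1)] g_sum tensor_rel_def)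
    with g(2) show False by simp
  qed
  define L where "L = (\<lambda>u. bilin_sum h (rep_tensor u))"
  have L: "L (abs_tensor zs) = bilin_sum h zs" for zs
    unfolding L_def by (intro sum_h) (metis Quotient3_tensor Quotient3_abs_rep tensor.abs_eq_iff)
  have abs: "\<exists>zs. u = abs_tensor zs" for u :: "('a, 'b) tensor"
    by (metis Quotient3_tensor Quotient3_abs_rep)
  have "linear L"
  proof (rule linearI)
    fix u v :: "('a, 'b) tensor" and r :: real
    obtain zs ws where "u = abs_tensor zs" "v = abs_tensor ws" using abs by metis
    then show "L (u + v) = L u + L v" and "L (r *\<^sub>R u) = r *\<^sub>R L u"
      by (simp_all add: plus_tensor.abs_eq scaleR_tensor.abs_eq L bilin_sum_scale[OF h])
  qed
  moreover have "L (tensor x y) = h x y" for x y by (simp add: tensor.abs_eq L)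
  ultimately show "\<exists>L. linear L \<and> (\<forall>x y. L (tensor x y) = h x y)" by blast
next
  fix L L' :: "('a, 'b) tensor \<Rightarrow> 'c"
  assume *: "linear L \<and> (\<forall>x y. L (tensor x y) = h x y)" "linear L' \<and> (\<forall>x y. L' (tensor x y) = h x y)"
  have "M (\<Sum>(x, y)\<leftarrow>zs. tensor x y) = bilin_sum h zs"
    if "linear M" "\<And>x y. M (tensor x y) = h x y" for M zs
    by (induction zs) (auto simp: that linear_0[OF that(1)] linear_add[OF that(1)])
  with * show "L = L'" by (intro ext) (metis tensor_sum_exists)
qed


section \<open>The projective norm\<close>

lemma bilin_sum_eq_0:
  fixes zs :: "('a::real_normed_vector \<times> 'b::real_vector) list" and B :: "'a \<Rightarrow> 'b \<Rightarrow> real"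
  assumes "\<And>f :: 'a \<Rightarrow> real. bounded_linear f \<Longrightarrow> bilin_sum (\<lambda>x y. f x *\<^sub>R y) zs = 0"
    and B: "bilinear B"
  shows "bilin_sum B zs = 0"
  using assms(1)
proof (induction "length zs" arbitrary: zs)
  case 0
  then show ?case by simp
next
  case (Suc n)
  then obtain x y ws where zs: "zs = (x, y) # ws" and len: "length ws = n"
    by (metis Suc_length_conv surj_pair)
  show ?case
  proof (cases "x = 0")
    case True
    have "bilin_sum B ws = 0"
      using Suc.prems len True zs by (intro Suc.hyps(1)) (auto simp: linear_0 bounded_linear.linear)
    then show ?thesis by (simp add: zs True bilinear_lzero[OF B])
  next
    case False
    then obtain f :: "'a \<Rightarrow> real" where f: "bounded_linear f" "f x \<noteq> 0"
      by (rule bounded_linear_separates)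
    define c where "c = (\<lambda>v. - f v / f x)"
    \<comment> \<open>\<open>y\<close> is a combination of the remaining second components, and can be eliminated\<close>
    have "f x *\<^sub>R y + bilin_sum (\<lambda>x y. f x *\<^sub>R y) ws = 0" using Suc.prems[OF f(1)] by (simp add: zs)
    then have "f x *\<^sub>R y = - bilin_sum (\<lambda>x y. f x *\<^sub>R y) ws" by (simp add: eq_neg_iff_add_eq_0)
    then have "inverse (f x) *\<^sub>R (f x *\<^sub>R y) =
        - (inverse (f x) *\<^sub>R bilin_sum (\<lambda>x y. f x *\<^sub>R y) ws)"
      by (metis scaleR_minus_right)
    then have "y = - (inverse (f x) *\<^sub>R bilin_sum (\<lambda>x y. f x *\<^sub>R y) ws)"
      using f(2) by simp
    also have "\<dots> = bilin_sum (\<lambda>v w. c v *\<^sub>R w) ws"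
      by (induction ws) (auto simp: c_def scaleR_add_right divide_inverse mult.commute)
    finally have y: "y = bilin_sum (\<lambda>v w. c v *\<^sub>R w) ws" .
    have elim: "bilin_sum D zs = bilin_sum D (map (\<lambda>(v, w). (v + c v *\<^sub>R x, w)) ws)"
      if D: "bilinear D" for D :: "'a \<Rightarrow> 'b \<Rightarrow> 'c::real_vector"
    proof -
      have "D x (bilin_sum (\<lambda>v w. c v *\<^sub>R w) us) + bilin_sum D us
          = bilin_sum D (map (\<lambda>(v, w). (v + c v *\<^sub>R x, w)) us)" for us
        by (induction us)
          (auto simp: bilinear_rzero[OF D] bilinear_radd[OF D] bilinear_ladd[OF D]
            bilinear_lmul[OF D] bilinear_rmul[OF D] algebra_simps)
      from this[of ws] show ?thesis by (simp only: zs bilin_sum_simps y[symmetric])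
    qed
    have "bilin_sum B (map (\<lambda>(v, w). (v + c v *\<^sub>R x, w)) ws) = 0"
    proof (rule Suc.hyps(1))
      fix g :: "'a \<Rightarrow> real" assume g: "bounded_linear g"
      have "bilinear (\<lambda>x (y :: 'b). g x *\<^sub>R y)"
        unfolding bilinear_def using linear_add[OF bounded_linear.linear[OF g]]
          linear_cmul[OF bounded_linear.linear[OF g]]
        by (auto intro!: linearI simp: algebra_simps)
      then show "bilin_sum (\<lambda>x y. g x *\<^sub>R y) (map (\<lambda>(v, w). (v + c v *\<^sub>R x, w)) ws) = 0"
        using elim Suc.prems[OF g] by metis
    qed (simp add: len)
    then show ?thesis using elim[OF B] by simp
  qed
qed

instantiation tensor :: (real_normed_vector, real_normed_vector) real_normed_vector
begin

definition norm_tensor :: "('a, 'b) tensor \<Rightarrow> real" where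
  "norm_tensor u = Inf {\<Sum>(x, y)\<leftarrow>zs. norm x * norm y | zs. u = (\<Sum>(x, y)\<leftarrow>zs. tensor x y)}"
definition sgn_tensor :: "('a, 'b) tensor \<Rightarrow> ('a, 'b) tensor" where "sgn_tensor u = u /\<^sub>R norm u"
definition dist_tensor :: "('a, 'b) tensor \<Rightarrow> ('a, 'b) tensor \<Rightarrow> real" where
  "dist_tensor u v = norm (u - v)"
definition "(uniformity :: (('a, 'b) tensor \<times> ('a, 'b) tensor) filter) =
  (INF e\<in>{0<..}. principal {(x, y). dist x y < e})"
definition open_tensor :: "('a, 'b) tensor set \<Rightarrow> bool" where
  "open_tensor S = (\<forall>x\<in>S. \<forall>\<^sub>F (x', y) in uniformity. x' = x \<longrightarrow> y \<in> S)"

lemma tensor_norm_le: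
  assumes "u = (\<Sum>(x, y)\<leftarrow>zs. tensor x y)"
  shows "norm (u :: ('a, 'b) tensor) \<le> (\<Sum>(x, y)\<leftarrow>zs. norm x * norm y)"
  unfolding norm_tensor_def using assms
  by (intro cInf_lower bdd_belowI[of _ 0]) (auto intro!: sum_list_nonneg)

lemma tensor_norm_greatest:
  assumes "\<And>zs. u = (\<Sum>(x, y)\<leftarrow>zs. tensor x y) \<Longrightarrow> c \<le> (\<Sum>(x, y)\<leftarrow>zs. norm x * norm y)"
  shows "c \<le> norm (u :: ('a, 'b) tensor)"
proof -
  obtain zs where "u = (\<Sum>(x, y)\<leftarrow>zs. tensor x y)" by (rule tensor_sum_exists)
  then show ?thesis unfolding norm_tensor_def using assms by (intro cInf_greatest) auto
qed

lemma tensor_norm_eq_0D: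
  assumes "norm (u :: ('a, 'b) tensor) = 0"
  shows "u = 0"
proof -
  obtain zs where zs: "u = (\<Sum>(x, y)\<leftarrow>zs. tensor x y)" by (rule tensor_sum_exists)
  have 0: "bilin_sum (\<lambda>x y. f x *\<^sub>R y) zs = 0" if f: "bounded_linear f" for f :: "'a \<Rightarrow> real"
  proof (rule ccontr)
    assume "\<not> ?thesis"
    then obtain g :: "'b \<Rightarrow> real" where g: "bounded_linear g" "g (bilin_sum (\<lambda>x y. f x *\<^sub>R y) zs) \<noteq> 0"
      by (rule bounded_linear_separates)
    define D where "D = (\<lambda>x y. f x * g y)"
    have lf: "linear f" and lg: "linear g" using f g(1) by (auto simp: bounded_linear.linear)
    have D: "bilinear D"
      unfolding bilinear_def D_def
      by (auto intro!: linearI simp: linear_add[OF lf] linear_add[OF lg] linear_cmul[OF lf]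
          linear_cmul[OF lg] algebra_simps)
    have gD: "g (bilin_sum (\<lambda>x y. f x *\<^sub>R y) us) = bilin_sum D us" for us
      by (induction us) (auto simp: D_def linear_0[OF lg] linear_add[OF lg] linear_cmul[OF lg])
    obtain K where K: "K > 0" "\<And>x. norm (f x) \<le> norm x * K" using bounded_linear.pos_bounded[OF f] by blast
    obtain M where M: "M > 0" "\<And>x. norm (g x) \<le> norm x * M" using bounded_linear.pos_bounded[OF g(1)] by blast
    have "\<bar>bilin_sum D zs\<bar> / (K * M) \<le> norm u"
    proof (rule tensor_norm_greatest)
      fix ws assume "u = (\<Sum>(x, y)\<leftarrow>ws. tensor x y)"
      then have "bilin_sum D zs = bilin_sum D ws"
        using D zs by (simp add: tensor_sum_eq_iff tensor_rel_def)
      have "\<bar>bilin_sum D us\<bar> \<le> K * M * (\<Sum>(x, y)\<leftarrow>us. norm x * norm y)" for us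
      proof (induction us)
        case (Cons z us)
        obtain x y where z: "z = (x, y)" by (cases z)
        have "\<bar>D x y\<bar> \<le> (norm x * K) * (norm y * M)"
          unfolding D_def abs_mult using K(2)[of x] M(2)[of y] K(1) by (intro mult_mono) auto
        then show ?case using Cons by (simp add: z algebra_simps)
      qed simp
      then show "\<bar>bilin_sum D zs\<bar> / (K * M) \<le> (\<Sum>(x, y)\<leftarrow>ws. norm x * norm y)"
        using \<open>bilin_sum D zs = bilin_sum D ws\<close> K(1) M(1) by (simp add: field_simps)
    qed
    then have "bilin_sum D zs = 0" using K(1) M(1) assms by (simp add: field_simps)
    with g(2) gD show False by simp
  qed
  have "tensor_rel zs []"
    unfolding tensor_rel_def using bilin_sum_eq_0[OF 0] by simp
  then have "u = (\<Sum>(x, y)\<leftarrow>[]. tensor x y)" unfolding zs tensor_sum_eq_iff .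
  then show ?thesis by simp
qed

instance
proof
  fix u v :: "('a, 'b) tensor" and r :: real and S :: "('a, 'b) tensor set"
  show "sgn u = u /\<^sub>R norm u" by (rule sgn_tensor_def)
  show "dist u v = norm (u - v)" by (rule dist_tensor_def)
  show "(uniformity :: (('a, 'b) tensor \<times> ('a, 'b) tensor) filter) =
      (INF e\<in>{0<..}. principal {(x, y). dist x y < e})"
    by (rule uniformity_tensor_def)
  show "open S \<longleftrightarrow> (\<forall>x\<in>S. \<forall>\<^sub>F (x', y) in uniformity. x' = x \<longrightarrow> y \<in> S)"
    by (rule open_tensor_def)
  have nonneg: "0 \<le> norm w" for w :: "('a, 'b) tensor"
    by (rule tensor_norm_greatest) (auto intro!: sum_list_nonneg)
  have norm_0: "norm (0 :: ('a, 'b) tensor) = 0"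
    using tensor_norm_le[of 0 "[]"] nonneg[of 0] by simp
  show "norm u = 0 \<longleftrightarrow> u = 0" using norm_0 tensor_norm_eq_0D by blast
  have "norm (u + v) - (\<Sum>(x, y)\<leftarrow>ws. norm x * norm y) \<le> norm u"
    if v: "v = (\<Sum>(x, y)\<leftarrow>ws. tensor x y)" for ws
  proof (rule tensor_norm_greatest)
    fix zs assume u: "u = (\<Sum>(x, y)\<leftarrow>zs. tensor x y)"
    have "norm (u + v) \<le> (\<Sum>(x, y)\<leftarrow>zs @ ws. norm x * norm y)"
      by (rule tensor_norm_le) (simp add: u v)
    then show "norm (u + v) - (\<Sum>(x, y)\<leftarrow>ws. norm x * norm y) \<le> (\<Sum>(x, y)\<leftarrow>zs. norm x * norm y)"
      by simp
  qed
  then have "norm (u + v) - norm u \<le> norm v"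
    by (intro tensor_norm_greatest) (simp add: algebra_simps)
  then show "norm (u + v) \<le> norm u + norm v" by simp
  have le: "norm (r *\<^sub>R w) \<le> \<bar>r\<bar> * norm w" for r and w :: "('a, 'b) tensor"
  proof (cases "r = 0")
    case True
    then show ?thesis by (simp add: norm_0)
  next
    case False
    have "norm (r *\<^sub>R w) / \<bar>r\<bar> \<le> norm w"
    proof (rule tensor_norm_greatest)
      fix zs assume w: "w = (\<Sum>(x, y)\<leftarrow>zs. tensor x y)"
      let ?m = "map (\<lambda>(x, y). (r *\<^sub>R x, y))"
      have "r *\<^sub>R w = (\<Sum>(x, y)\<leftarrow>?m zs. tensor x y)"
        unfolding w abs_tensor_eq[symmetric] by (rule scaleR_tensor.abs_eq)
      then have "norm (r *\<^sub>R w) \<le> (\<Sum>(x, y)\<leftarrow>?m zs. norm x * norm y)" by (rule tensor_norm_le)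
      also have "\<dots> = \<bar>r\<bar> * (\<Sum>(x, y)\<leftarrow>zs. norm x * norm y)"
        by (induction zs) (auto simp: algebra_simps)
      finally show "norm (r *\<^sub>R w) / \<bar>r\<bar> \<le> (\<Sum>(x, y)\<leftarrow>zs. norm x * norm y)"
        using False by (simp add: field_simps)
    qed
    then show ?thesis using False by (simp add: field_simps)
  qed
  have "\<bar>r\<bar> * norm u \<le> norm (r *\<^sub>R u)"
  proof (cases "r = 0")
    case True
    then show ?thesis by (simp add: norm_0)
  next
    case False
    then show ?thesis using le[of "inverse r" "r *\<^sub>R u"] by (simp add: field_simps)
  qed
  then show "norm (r *\<^sub>R u) = \<bar>r\<bar> * norm u" by (rule antisym[OF le])
qed

end


section \<open>Completion of a normed space\<close>

lemma Cauchy_plus: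
  fixes X Y :: "nat \<Rightarrow> 'a::real_normed_vector"
  assumes "Cauchy X" and "Cauchy Y"
  shows "Cauchy (\<lambda>n. X n + Y n)"
proof (rule metric_CauchyI)
  fix e :: real assume "e > 0"
  then have "e/2 > 0" by simp
  obtain M where M: "\<And>m n. m \<ge> M \<Longrightarrow> n \<ge> M \<Longrightarrow> dist (X m) (X n) < e/2"
    using metric_CauchyD[OF assms(1) \<open>e/2 > 0\<close>] by blast
  obtain N where N: "\<And>m n. m \<ge> N \<Longrightarrow> n \<ge> N \<Longrightarrow> dist (Y m) (Y n) < e/2"
    using metric_CauchyD[OF assms(2) \<open>e/2 > 0\<close>] by blast
  have "dist (X m + Y m) (X n + Y n) < e" if "m \<ge> max M N" "n \<ge> max M N" for m n
    using dist_triangle_add[of "X m" "Y m" "X n" "Y n"] M[of m n] N[of m n] that by simp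
  then show "\<exists>K. \<forall>m\<ge>K. \<forall>n\<ge>K. dist (X m + Y m) (X n + Y n) < e" by blast
qed

lemma Cauchy_constant: "Cauchy (\<lambda>_. x :: 'a::real_normed_vector)"
  by (rule LIMSEQ_imp_Cauchy[OF tendsto_const])

lemmas Cauchy_scaleR = bounded_linear.Cauchy[OF bounded_linear_scaleR_right]

definition completion_rel :: "(nat \<Rightarrow> 'a::real_normed_vector) \<Rightarrow> (nat \<Rightarrow> 'a) \<Rightarrow> bool" where
  "completion_rel X Y \<longleftrightarrow> Cauchy X \<and> Cauchy Y \<and> (\<lambda>n. X n - Y n) \<longlonglongrightarrow> 0"

lemmas completion_rel_simps = completion_rel_def Cauchy_plus Cauchy_scaleR Cauchy_constant

quotient_type (overloaded) 'a completion = "nat \<Rightarrow> 'a::real_normed_vector" / partial: completion_rel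
proof (rule part_equivpI)
  show "\<exists>X. completion_rel X (X :: nat \<Rightarrow> 'a)"
    by (rule exI[of _ "\<lambda>_. 0"]) (simp add: completion_rel_def Cauchy_constant)
  show "symp (completion_rel :: (nat \<Rightarrow> 'a) \<Rightarrow> _)"
  proof (rule sympI)
    fix X Y :: "nat \<Rightarrow> 'a"
    assume "completion_rel X Y"
    then show "completion_rel Y X"
      using tendsto_minus[of "\<lambda>n. X n - Y n" 0 sequentially] by (simp add: completion_rel_def)
  qed
  show "transp (completion_rel :: (nat \<Rightarrow> 'a) \<Rightarrow> _)"
  proof (rule transpI)
    fix X Y Z :: "nat \<Rightarrow> 'a"
    assume "completion_rel X Y" "completion_rel Y Z"
    then show "completion_rel X Z"
      using tendsto_add[of "\<lambda>n. X n - Y n" 0 sequentially "\<lambda>n. Y n - Z n" 0]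
      by (simp add: completion_rel_def)
  qed
qed

instantiation completion :: (real_normed_vector) real_vector
begin

lift_definition zero_completion :: "'a completion" is "\<lambda>_. 0"
  by (simp add: completion_rel_def Cauchy_constant)

lift_definition plus_completion :: "'a completion \<Rightarrow> 'a completion \<Rightarrow> 'a completion"
  is "\<lambda>X Y n. X n + Y n"
  by (simp add: completion_rel_simps add_diff_add tendsto_add_zero)

lift_definition scaleR_completion :: "real \<Rightarrow> 'a completion \<Rightarrow> 'a completion"
  is "\<lambda>r X n. r *\<^sub>R X n"
  by (simp add: completion_rel_simps bounded_linear.tendsto_zero[OF bounded_linear_scaleR_right]
      flip: scaleR_diff_right)

definition uminus_completion :: "'a completion \<Rightarrow> 'a completion" where
  "uminus_completion x = (- 1) *\<^sub>R x"

definition minus_completion :: "'a completion \<Rightarrow> 'a completion \<Rightarrow> 'a completion" where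
  "minus_completion x y = x + (- y)"

instance
proof
  fix a b c :: "'a completion" and r s :: real
  show "a + b + c = a + (b + c)" by transfer (simp add: completion_rel_simps add.assoc)
  show "a + b = b + a" by transfer (simp add: completion_rel_simps add.commute)
  show "0 + a = a" by transfer (simp add: completion_rel_simps)
  show "- a + a = 0"
    unfolding uminus_completion_def by transfer (simp add: completion_rel_simps)
  show "a - b = a + - b" by (rule minus_completion_def)
  show "r *\<^sub>R (a + b) = r *\<^sub>R a + r *\<^sub>R b"
    by transfer (simp add: completion_rel_simps scaleR_add_right)
  show "(r + s) *\<^sub>R a = r *\<^sub>R a + s *\<^sub>R a"
    by transfer (simp add: completion_rel_simps scaleR_add_left)
  show "r *\<^sub>R s *\<^sub>R a = (r * s) *\<^sub>R a" by transfer (simp add: completion_rel_simps)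
  show "1 *\<^sub>R a = a" by transfer (simp add: completion_rel_simps)
qed

end

lemma completion_obtain_Cauchy:
  fixes z :: "'a::real_normed_vector completion"
  obtains X where "Cauchy X" and "z = abs_completion X"
proof
  show "z = abs_completion (rep_completion z)"
    by (simp add: Quotient3_abs_rep[OF Quotient3_completion])
  show "Cauchy (rep_completion z)"
    using Quotient3_rep_reflp[OF Quotient3_completion, of z] by (simp add: completion_rel_def)
qed

lemma completion_rel_refl: "completion_rel X X \<longleftrightarrow> Cauchy X"
  by (simp add: completion_rel_def)

lemma Cauchy_norm: "Cauchy X \<Longrightarrow> convergent (\<lambda>n. norm (X n :: 'a::real_normed_vector))"
proof -
  assume X: "Cauchy X"
  have "Cauchy (\<lambda>n. norm (X n))"
  proof (rule metric_CauchyI)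
    fix e :: real assume "e > 0"
    then obtain N where N: "\<And>m n. m \<ge> N \<Longrightarrow> n \<ge> N \<Longrightarrow> dist (X m) (X n) < e"
      using metric_CauchyD[OF X] by meson
    have "dist (norm (X m)) (norm (X n)) \<le> dist (X m) (X n)" for m n
      by (simp add: dist_norm norm_triangle_ineq3)
    then show "\<exists>N. \<forall>m\<ge>N. \<forall>n\<ge>N. dist (norm (X m)) (norm (X n)) < e"
      using N le_less_trans by blast
  qed
  then show ?thesis by (simp add: Cauchy_convergent_iff)
qed

instantiation completion :: (real_normed_vector) real_normed_vector
begin

lift_definition norm_completion :: "'a completion \<Rightarrow> real" is "\<lambda>X. lim (\<lambda>n. norm (X n))"
proof -
  fix X Y :: "nat \<Rightarrow> 'a"
  assume XY: "completion_rel X Y"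
  then have "(\<lambda>n. norm (X n)) \<longlonglongrightarrow> lim (\<lambda>n. norm (X n))"
    by (simp add: completion_rel_def Cauchy_norm convergent_LIMSEQ_iff[symmetric])
  moreover have "(\<lambda>n. norm (X n) - norm (Y n)) \<longlonglongrightarrow> 0"
  proof (rule Lim_null_comparison)
    show "(\<lambda>n. norm (X n - Y n)) \<longlonglongrightarrow> 0"
      using XY by (simp add: completion_rel_def tendsto_norm_zero)
    show "\<forall>\<^sub>F n in sequentially. norm (norm (X n) - norm (Y n)) \<le> norm (X n - Y n)"
      by (simp add: norm_triangle_ineq3)
  qed
  ultimately have "(\<lambda>n. norm (X n) - (norm (X n) - norm (Y n))) \<longlonglongrightarrow> lim (\<lambda>n. norm (X n)) - 0"
    by (rule tendsto_diff)
  then show "lim (\<lambda>n. norm (X n)) = lim (\<lambda>n. norm (Y n))" by (simp add: limI)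
qed

definition sgn_completion :: "'a completion \<Rightarrow> 'a completion" where
  "sgn_completion x = x /\<^sub>R norm x"
definition dist_completion :: "'a completion \<Rightarrow> 'a completion \<Rightarrow> real" where
  "dist_completion x y = norm (x - y)"
definition "(uniformity :: ('a completion \<times> 'a completion) filter) =
  (INF e\<in>{0<..}. principal {(x, y). dist x y < e})"
definition open_completion :: "'a completion set \<Rightarrow> bool" where
  "open_completion S = (\<forall>x\<in>S. \<forall>\<^sub>F (x', y) in uniformity. x' = x \<longrightarrow> y \<in> S)"

lemma completion_norm_tendsto:
  "Cauchy X \<Longrightarrow> (\<lambda>n. norm (X n)) \<longlonglongrightarrow> norm (abs_completion X :: 'a completion)"
  using Cauchy_norm[of X]
  by (simp add: norm_completion.abs_eq completion_rel_refl convergent_LIMSEQ_iff)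

instance
proof
  fix x y :: "'a completion" and r :: real and S :: "'a completion set"
  show "sgn x = x /\<^sub>R norm x" by (rule sgn_completion_def)
  show "dist x y = norm (x - y)" by (rule dist_completion_def)
  show "(uniformity :: ('a completion \<times> 'a completion) filter) =
      (INF e\<in>{0<..}. principal {(x, y). dist x y < e})"
    by (rule uniformity_completion_def)
  show "open S \<longleftrightarrow> (\<forall>x\<in>S. \<forall>\<^sub>F (x', y) in uniformity. x' = x \<longrightarrow> y \<in> S)"
    by (rule open_completion_def)
  obtain X where X: "Cauchy X" "x = abs_completion X" by (rule completion_obtain_Cauchy)
  obtain Y where Y: "Cauchy Y" "y = abs_completion Y" by (rule completion_obtain_Cauchy)
  note lX = completion_norm_tendsto[OF X(1), folded X(2)]
  note lY = completion_norm_tendsto[OF Y(1), folded Y(2)]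
  show "norm x = 0 \<longleftrightarrow> x = 0"
  proof
    assume "norm x = 0"
    with lX have "X \<longlonglongrightarrow> 0" by (simp add: tendsto_norm_zero_iff)
    moreover have "Cauchy (\<lambda>_. 0 :: 'a)" by (rule Cauchy_constant)
    ultimately have "completion_rel X (\<lambda>_. 0)" using X(1) by (simp add: completion_rel_def)
    then show "x = 0"
      unfolding X(2) zero_completion_def by (simp add: Quotient3_rel_abs[OF Quotient3_completion])
  next
    assume "x = 0"
    then show "norm x = 0"
      by (simp add: zero_completion_def norm_completion.abs_eq completion_rel_simps)
  qed
  have "x + y = abs_completion (\<lambda>n. X n + Y n)"
    using X Y by (simp add: plus_completion.abs_eq completion_rel_refl)
  then have "(\<lambda>n. norm (X n + Y n)) \<longlonglongrightarrow> norm (x + y)"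
    using completion_norm_tendsto[OF Cauchy_plus[OF X(1) Y(1)]] by simp
  then show "norm (x + y) \<le> norm x + norm y"
    by (rule LIMSEQ_le[OF _ tendsto_add[OF lX lY]]) (simp add: norm_triangle_ineq)
  have "r *\<^sub>R x = abs_completion (\<lambda>n. r *\<^sub>R X n)"
    using X by (simp add: scaleR_completion.abs_eq completion_rel_refl)
  then have "(\<lambda>n. norm (r *\<^sub>R X n)) \<longlonglongrightarrow> norm (r *\<^sub>R x)"
    using completion_norm_tendsto[OF Cauchy_scaleR[OF X(1)]]
    by simp
  moreover have "(\<lambda>n. norm (r *\<^sub>R X n)) \<longlonglongrightarrow> \<bar>r\<bar> * norm x"
    using tendsto_mult_left[OF lX, of "\<bar>r\<bar>"] by simp
  ultimately show "norm (r *\<^sub>R x) = \<bar>r\<bar> * norm x" by (rule LIMSEQ_unique)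
qed

end

lift_definition completion_embed :: "'a::real_normed_vector \<Rightarrow> 'a completion" is "\<lambda>x _. x"
  by (simp add: completion_rel_def Cauchy_constant)

lemma linear_completion_embed: "linear completion_embed"
  by (rule linearI; transfer) (simp_all add: completion_rel_def Cauchy_constant)

lemma norm_completion_embed: "norm (completion_embed x) = norm x"
  by transfer (simp add: limI)

lemma completion_embed_tendsto:
  fixes X :: "nat \<Rightarrow> 'a::real_normed_vector"
  assumes X: "Cauchy X"
  shows "(\<lambda>n. completion_embed (X n)) \<longlonglongrightarrow> abs_completion X"
proof (rule metric_LIMSEQ_I)
  fix e :: real assume "e > 0"
  then have "e/2 > 0" by simp
  from metric_CauchyD[OF X this] obtain N
    where N: "\<And>m n. m \<ge> N \<Longrightarrow> n \<ge> N \<Longrightarrow> dist (X m) (X n) < e/2" by blast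
  have "dist (completion_embed (X n)) (abs_completion X) < e" if "n \<ge> N" for n
  proof -
    have c: "Cauchy (\<lambda>_. X n)" by (rule Cauchy_constant)
    have m: "Cauchy (\<lambda>m. (- 1) *\<^sub>R X m)"
      by (rule Cauchy_scaleR[OF X])
    have "completion_embed (X n) - abs_completion X = abs_completion (\<lambda>m. X n + (- 1) *\<^sub>R X m)"
      unfolding minus_completion_def uminus_completion_def completion_embed.abs_eq
      using c m X by (simp add: scaleR_completion.abs_eq plus_completion.abs_eq completion_rel_refl
          completion_embed_def del: scaleR_minus_left scaleR_minus1_left)
    then have "(\<lambda>m. norm (X n + (- 1) *\<^sub>R X m)) \<longlonglongrightarrow> dist (completion_embed (X n)) (abs_completion X)"
      using completion_norm_tendsto[OF Cauchy_plus[OF c m]] by (simp add: dist_norm)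
    moreover have "norm (X n + (- 1) *\<^sub>R X m) \<le> e/2" if "m \<ge> N" for m
      using N[OF \<open>n \<ge> N\<close> that] by (simp add: dist_norm)
    ultimately have "dist (completion_embed (X n)) (abs_completion X) \<le> e/2"
      by (intro LIMSEQ_le_const2) auto
    then show ?thesis using \<open>e > 0\<close> by simp
  qed
  then show "\<exists>N. \<forall>n\<ge>N. dist (completion_embed (X n)) (abs_completion X) < e" by blast
qed

lemma completion_embed_dense: "closure (range completion_embed) = UNIV"
proof -
  have "z \<in> closure (range completion_embed)" for z :: "'a completion"
  proof -
    obtain X where "Cauchy X" "z = abs_completion X" by (rule completion_obtain_Cauchy)
    then have "(\<lambda>n. completion_embed (X n)) \<longlonglongrightarrow> z" by (simp add: completion_embed_tendsto)
    then show ?thesis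
      unfolding closure_sequential by (intro exI[of _ "\<lambda>n. completion_embed (X n)"]) simp
  qed
  then show ?thesis by blast
qed

instance completion :: (real_normed_vector) banach
proof
  fix Z :: "nat \<Rightarrow> 'a completion"
  assume Z: "Cauchy Z"
  have "\<exists>x. dist (completion_embed x) (Z k) < inverse (real (Suc k))" for k
  proof -
    have "Z k \<in> closure (range completion_embed)" by (simp add: completion_embed_dense)
    moreover have "0 < inverse (real (Suc k))" by simp
    ultimately show ?thesis unfolding closure_approachable by blast
  qed
  then obtain x where x: "\<And>k. dist (completion_embed (x k)) (Z k) < inverse (real (Suc k))" by metis
  have "(\<lambda>k. dist (completion_embed (x k)) (Z k)) \<longlonglongrightarrow> 0"
    by (rule tendsto_sandwich[OF _ _ tendsto_const LIMSEQ_inverse_real_of_nat])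
      (use x in \<open>simp_all add: less_imp_le del: of_nat_Suc\<close>)
  then have diff: "(\<lambda>k. completion_embed (x k) - Z k) \<longlonglongrightarrow> 0"
    by (simp add: dist_norm tendsto_norm_zero_iff)
  then have "Cauchy (\<lambda>k. (completion_embed (x k) - Z k) + Z k)"
    by (intro Cauchy_plus Z LIMSEQ_imp_Cauchy)
  then have "Cauchy (\<lambda>k. completion_embed (x k))" by simp
  moreover have "dist (completion_embed u) (completion_embed v) = dist u v" for u v :: 'a
    by (simp add: dist_norm norm_completion_embed flip: linear_diff[OF linear_completion_embed])
  ultimately have "Cauchy x" by (simp add: Cauchy_def)
  then have "(\<lambda>k. completion_embed (x k) - (completion_embed (x k) - Z k))
      \<longlonglongrightarrow> abs_completion x - 0"
    by (intro tendsto_diff completion_embed_tendsto diff)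
  then show "convergent Z" by (auto intro: convergentI)
qed

type_synonym ('a, 'b) proj_tensor = "('a, 'b) tensor completion"


section \<open>Properties of norms and of dual spaces\<close>

definition finite_dimensional :: "'a::real_vector itself \<Rightarrow> bool" where
  "finite_dimensional _ \<longleftrightarrow> (\<exists>B :: 'a set. finite B \<and> span B = UNIV)"

definition gateaux_differentiable_at :: "('a::real_normed_vector \<Rightarrow> real) \<Rightarrow> 'a \<Rightarrow> bool" where
  "gateaux_differentiable_at f x \<longleftrightarrow>
    (\<exists>f'. bounded_linear f' \<and> (\<forall>h. ((\<lambda>t. (f (x + t *\<^sub>R h) - f x) / t) \<longlongrightarrow> f' h) (at 0)))"

definition smooth_space :: "'a::real_normed_vector itself \<Rightarrow> bool" where
  "smooth_space _ \<longleftrightarrow> (\<forall>x\<in>sphere 0 1. gateaux_differentiable_at (norm :: 'a \<Rightarrow> real) x)"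

definition SSD_at :: "'a::real_normed_vector \<Rightarrow> bool" where
  "SSD_at x \<longleftrightarrow>
    (\<exists>d. uniform_limit (sphere 0 1) (\<lambda>t h. (norm (x + t *\<^sub>R h) - 1) / t) d (at_right 0))"

definition SSD_norm :: "'a::real_normed_vector itself \<Rightarrow> bool" where
  "SSD_norm _ \<longleftrightarrow> (\<forall>x :: 'a. x \<in> sphere 0 1 \<longrightarrow> SSD_at x)"

text \<open>For functionals, the topology of pointwise convergence is the weak-star topology.\<close>

abbreviation weak_star_topology :: "('a::real_normed_vector \<Rightarrow>\<^sub>L real) topology" where
  "weak_star_topology \<equiv> strong_operator_topology"

definition directed_by :: "('s \<Rightarrow> 's \<Rightarrow> bool) \<Rightarrow> 's set \<Rightarrow> bool" where
  "directed_by le S \<longleftrightarrow> S \<noteq> {} \<and> (\<forall>s\<in>S. le s s) \<and>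
    (\<forall>s\<in>S. \<forall>t\<in>S. \<forall>u\<in>S. le s t \<longrightarrow> le t u \<longrightarrow> le s u) \<and>
    (\<forall>s\<in>S. \<forall>t\<in>S. \<exists>u\<in>S. le s u \<and> le t u)"

text \<open>The filter generated by the tails of a directed set, along which nets converge.\<close>

definition net_filter :: "('s \<Rightarrow> 's \<Rightarrow> bool) \<Rightarrow> 's set \<Rightarrow> 's filter" where
  "net_filter le S = (INF s\<in>S. principal {t\<in>S. le s t})"

lemma eventually_net_filter:
  assumes "directed_by le S"
  shows "eventually P (net_filter le S) \<longleftrightarrow> (\<exists>s\<in>S. \<forall>t\<in>S. le s t \<longrightarrow> P t)"
  unfolding net_filter_def
proof (subst eventually_INF_base)
  show "S \<noteq> {}" using assms by (simp add: directed_by_def)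
  fix s t assume "s \<in> S" "t \<in> S"
  with assms obtain u where "u \<in> S" "le s u" "le t u" unfolding directed_by_def by meson
  moreover have trans: "le r w" if "r \<in> S" "v \<in> S" "w \<in> S" "le r v" "le v w" for r v w
    using assms that unfolding directed_by_def by blast
  ultimately have "{v\<in>S. le u v} \<subseteq> {v\<in>S. le s v} \<inter> {v\<in>S. le t v}"
    using \<open>s \<in> S\<close> \<open>t \<in> S\<close> by blast
  with \<open>u \<in> S\<close>
  show "\<exists>x\<in>S. principal {v\<in>S. le x v} \<le> inf (principal {v\<in>S. le s v}) (principal {v\<in>S. le t v})"
    by auto
qed (auto simp: eventually_principal)

text \<open>
  The property is about the space \<open>'a\<close>, whose dual is \<open>'a \<Rightarrow>\<^sub>L real\<close>. A definition cannot
  quantify over types, so the type \<open>'s\<close> of the net indices is a parameter; it has to be left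
  arbitrary for the property to be about all nets.
\<close>

definition weak_star_Kadec_Klee_dual :: "'s itself \<Rightarrow> 'a::real_normed_vector itself \<Rightarrow> bool" where
  "weak_star_Kadec_Klee_dual _ _ \<longleftrightarrow>
    (\<forall>le (S :: 's set) (f :: 's \<Rightarrow> 'a \<Rightarrow>\<^sub>L real) g.
      directed_by le S \<and> (\<forall>s\<in>S. f s \<in> sphere 0 1) \<and> g \<in> sphere 0 1 \<and>
      limitin weak_star_topology f g (net_filter le S)
      \<longrightarrow> ((\<lambda>s. norm (f s - g)) \<longlongrightarrow> 0) (net_filter le S))"

end

theory Submission
  imports Defs
begin

text \<open>
  Functionals on the projective tensor product are bilinear forms on \<open>c\<^sub>0(I) \<times> Y\<close>. The main point is
  that a functional \<open>R\<close> in the unit ball which almost attains the value 1 at \<open>u \<otimes> y\<close>, for a finitely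
  supported \<open>u\<close> in the ball and a unit vector \<open>y\<close>, is almost carried by the support of \<open>u\<close>. A vector
  \<open>v\<close> supported elsewhere can be added to and subtracted from \<open>u\<close> without leaving the ball, and
  smoothness of the norm at \<open>y\<close> forces \<open>R (v \<otimes> h)\<close> to be small (\<open>disjoint_tail_small\<close>).

  If functionals \<open>f\<^sub>s\<close> in the ball converge weak-star to \<open>g\<close> of norm 1, then a point \<open>y\<close> at which \<open>g\<close>
  attains its norm in the second factor exists by compactness of the ball of \<open>Y\<close>
  (\<open>norm_attained_in_second_factor\<close>). One finite set of coordinates then carries \<open>g\<close> and almost all
  \<open>f\<^sub>s\<close> up to a small error. On finitely many coordinates, and on a finite net of the ball of \<open>Y\<close>,
  pointwise convergence is uniform; hence \<open>f\<^sub>s\<close> converges in norm (\<open>c0_tensor_dual_Kadec_Klee\<close>).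

  Strong subdifferentiability holds in any space whose dual has this property: by Banach-Alaoglu, a
  functional almost norming at a unit vector is close to a functional that is norming there
  (\<open>Kadec_Klee_near_face\<close>), which controls the difference quotients of the norm uniformly in the
  direction (\<open>Kadec_Klee_imp_SSD\<close>).
\<close>

section \<open>Compactness of the unit ball in finite dimension\<close>

text \<open>
  The dimension is not a type here, so compactness is obtained by adding one spanning vector
  \<open>b\<close> at a time. The span already treated is closed, by the induction hypothesis, so \<open>b\<close> has
  positive distance \<open>d\<close> from it. This distance bounds the coefficient of \<open>b\<close> in a bounded
  sequence, and Bolzano-Weierstrass applies to these coefficients.
\<close>

lemma span_bounded_subseq:
  fixes B :: "'a::real_normed_vector set" and x :: "nat \<Rightarrow> 'a"
  assumes "finite B" and "range x \<subseteq> span B" and "bounded (range x)"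
  shows "\<exists>l\<in>span B. \<exists>r. strict_mono r \<and> (x \<circ> r) \<longlonglongrightarrow> l"
  using assms
proof (induction B arbitrary: x rule: finite_induct)
  case empty
  then have "x = (\<lambda>_. 0)" by auto
  then have "strict_mono (id :: nat \<Rightarrow> nat) \<and> (x \<circ> id) \<longlonglongrightarrow> 0"
    by (simp add: strict_mono_def)
  then show ?case by (auto intro: span_zero)
next
  case (insert b B)
  show ?case
  proof (cases "b \<in> span B")
    case True
    then show ?thesis using insert by (simp add: span_redundant)
  next
    case False
    have "l \<in> span B" if u: "\<forall>n. u n \<in> span B" "u \<longlonglongrightarrow> l" for u l
    proof -
      have "bounded (range u)" using u(2) by (intro convergent_imp_bounded) (auto simp: convergent_def)
      with u(1) obtain l' r where "l' \<in> span B" "strict_mono r" "(u \<circ> r) \<longlonglongrightarrow> l'"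
        using insert.IH[of u] by (metis image_subset_iff)
      then show ?thesis using LIMSEQ_subseq_LIMSEQ[OF u(2)] LIMSEQ_unique by metis
    qed
    then have "closed (span B)" by (auto simp: closed_sequential_limits)
    then obtain d where d: "d > 0" "\<And>s. s \<in> span B \<Longrightarrow> d \<le> norm (b - s)"
      using False open_contains_ball[of "- span B"]
      by (force simp: open_Compl subset_iff dist_norm not_less)
    have "\<forall>n. \<exists>k. x n - k *\<^sub>R b \<in> span B"
      using insert.prems(1) by (auto simp: span_breakdown_eq image_subset_iff)
    then obtain c where c: "\<And>n. x n - c n *\<^sub>R b \<in> span B" by metis
    have c_le: "\<bar>c n\<bar> * d \<le> norm (x n)" for n
    proof (cases "c n = 0")
      case nz: False
      have "- inverse (c n) *\<^sub>R (x n - c n *\<^sub>R b) \<in> span B" by (rule span_mul[OF c])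
      from d(2)[OF this] have "d \<le> norm (inverse (c n) *\<^sub>R x n)"
        using nz by (simp add: algebra_simps)
      then show ?thesis using nz by (simp add: field_simps)
    qed simp
    obtain M where M: "\<And>n. norm (x n) \<le> M"
      using insert.prems(2) by (auto simp: bounded_iff)
    have "\<bar>c n\<bar> \<le> M / d" for n
      using order_trans[OF c_le M, of n] d(1) by (simp add: field_simps)
    then have "bounded (range c)" by (auto simp: bounded_iff)
    then obtain c0 r where r: "strict_mono r" "(c \<circ> r) \<longlonglongrightarrow> c0"
      using bounded_imp_convergent_subsequence by metis
    define s where "s = (\<lambda>n. x (r n) - c (r n) *\<^sub>R b)"
    have "norm (s n) \<le> M + M / d * norm b" for n
    proof -
      have "norm (s n) \<le> norm (x (r n)) + \<bar>c (r n)\<bar> * norm b"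
        unfolding s_def using norm_triangle_ineq4[of "x (r n)" "c (r n) *\<^sub>R b"] by simp
      also have "\<dots> \<le> M + M / d * norm b"
        by (intro add_mono mult_right_mono M \<open>\<And>n. \<bar>c n\<bar> \<le> M / d\<close>) simp
      finally show ?thesis .
    qed
    then have "bounded (range s)" by (auto simp: bounded_iff)
    moreover have "range s \<subseteq> span B" using c by (auto simp: s_def)
    ultimately obtain l q where q: "l \<in> span B" "strict_mono q" "(s \<circ> q) \<longlonglongrightarrow> l"
      using insert.IH[of s] by metis
    have "(\<lambda>n. c (r (q n)) *\<^sub>R b + s (q n)) \<longlonglongrightarrow> c0 *\<^sub>R b + l"
      using LIMSEQ_subseq_LIMSEQ[OF r(2) q(2)] q(3) by (intro tendsto_intros) (simp_all add: o_def)
    then have "(x \<circ> (r \<circ> q)) \<longlonglongrightarrow> c0 *\<^sub>R b + l" by (simp add: s_def o_def)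
    moreover have "strict_mono (r \<circ> q)" using r(1) q(2) by (rule strict_mono_o)
    moreover have "c0 *\<^sub>R b + l \<in> span (insert b B)"
      unfolding span_breakdown_eq using q(1) by (intro exI[of _ c0]) simp
    ultimately show ?thesis by blast
  qed
qed

lemma finite_dimensional_compact_cball:
  assumes "finite_dimensional TYPE('y::real_normed_vector)"
  shows "compact (cball (0 :: 'y) 1)"
proof -
  obtain B :: "'y set" where B: "finite B" "span B = UNIV"
    using assms by (auto simp: finite_dimensional_def)
  show ?thesis unfolding compact_def
  proof (intro allI impI)
    fix x :: "nat \<Rightarrow> 'y" assume x: "\<forall>n. x n \<in> cball 0 1"
    then have "bounded (range x)" by (auto simp: bounded_iff)
    then obtain l r where l: "strict_mono r" "(x \<circ> r) \<longlonglongrightarrow> l"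
      using span_bounded_subseq[OF B(1), of x] B(2) by auto
    moreover have "l \<in> cball 0 1"
      using closed_sequentially[OF closed_cball _ l(2), of 0 1] x by simp
    ultimately show "\<exists>l\<in>cball 0 1. \<exists>r. strict_mono r \<and> (x \<circ> r) \<longlonglongrightarrow> l" by blast
  qed
qed

section \<open>From the Kadec-Klee property to strong subdifferentiability\<close>

text \<open>
  A linear functional below the shift of the norm in the direction \<open>w\<close> is at most
  \<open>- norm w\<close> at \<open>- w\<close>, which makes it norming for \<open>w\<close>.
\<close>

lemma norming_functional:
  fixes w :: "'a::real_normed_vector"
  obtains f :: "'a \<Rightarrow>\<^sub>L real" where "norm f \<le> 1" and "blinfun_apply f w = norm w"
proof -
  have n: "sublinear (norm :: 'a \<Rightarrow> real)" by (simp add: sublinear_def norm_triangle_ineq)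
  define p where "p = (\<lambda>z. INF t\<in>{0..}. norm (z + t *\<^sub>R w) - t * norm w)"
  have "sublinear p" unfolding p_def by (rule sublinear_shift(1)[OF n])
  then obtain f where f: "linear f" "\<And>z. f z \<le> p z"
    using sublinear_dominates_linear by metis
  have pn: "p z \<le> norm z" and pw: "p z \<le> norm (z + w) - norm w" for z
    unfolding p_def using sublinear_shift(2,3)[OF n] by blast+
  have le: "\<bar>f z\<bar> \<le> norm z" for z
    using f(2)[of z] f(2)[of "- z"] pn[of z] pn[of "- z"] linear_neg[OF f(1), of z] by simp
  then have bl: "bounded_linear f"
    using f(1) by (intro bounded_linear_intro[where K=1]) (auto simp: linear_add linear_cmul)
  have "f w = norm w"
    using f(2)[of "- w"] pw[of "- w"] linear_neg[OF f(1), of w] le[of w] by simp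
  moreover have "norm (Blinfun f) \<le> 1"
    by (rule norm_blinfun_bound) (simp_all add: bounded_linear_Blinfun_apply[OF bl] le)
  ultimately show ?thesis using that[of "Blinfun f"] bl by (simp add: bounded_linear_Blinfun_apply)
qed

text \<open>
  The \<open>w\<^sup>*\<close>-Kadec-Klee property with filters in place of nets. Approximating functionals are only
  required to lie in the unit ball. Filters on the dual itself can then be used to prove strong
  subdifferentiability, where limits come from compactness and not from a given net.
\<close>

definition dual_Kadec_Klee_on_filters :: "'a::real_normed_vector itself \<Rightarrow> 's itself \<Rightarrow> bool" where
  "dual_Kadec_Klee_on_filters _ _ \<longleftrightarrow>
    (\<forall>(F :: 's filter) (f :: 's \<Rightarrow> 'a \<Rightarrow>\<^sub>L real) g.
      (\<forall>\<^sub>F s in F. norm (f s) \<le> 1) \<and> norm g = 1 \<and> (\<forall>x. ((\<lambda>s. blinfun_apply (f s) x) \<longlongrightarrow> blinfun_apply g x) F)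
      \<longrightarrow> ((\<lambda>s. norm (f s - g)) \<longlongrightarrow> 0) F)"

lemma Kadec_Klee_on_nets:
  assumes "dual_Kadec_Klee_on_filters TYPE('a::real_normed_vector) TYPE('s)"
  shows "weak_star_Kadec_Klee_dual TYPE('s) TYPE('a)"
  unfolding weak_star_Kadec_Klee_dual_def
proof (intro allI impI, elim conjE)
  fix le and S :: "'s set" and f :: "'s \<Rightarrow> 'a \<Rightarrow>\<^sub>L real" and g
  assume dir: "directed_by le S" and f: "\<forall>s\<in>S. f s \<in> sphere 0 1" and g: "g \<in> sphere 0 1"
    and lim: "limitin weak_star_topology f g (net_filter le S)"
  have "\<forall>\<^sub>F s in net_filter le S. norm (f s) \<le> 1"
  proof -
    obtain s where "s \<in> S" using dir by (auto simp: directed_by_def)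
    moreover have "\<forall>t\<in>S. norm (f t) \<le> 1" using f by simp
    ultimately show ?thesis unfolding eventually_net_filter[OF dir] by blast
  qed
  moreover have "((\<lambda>s. blinfun_apply (f s) x) \<longlongrightarrow> blinfun_apply g x) (net_filter le S)" for x
    using continuous_map_limit[OF strong_operator_topology_continuous_evaluation lim]
    by (simp add: o_def)
  ultimately show "((\<lambda>s. norm (f s - g)) \<longlongrightarrow> 0) (net_filter le S)"
    using assms g unfolding dual_Kadec_Klee_on_filters_def by simp
qed

text \<open>
  Functionals almost norming at \<open>z\<close> are close in norm to functionals norming at \<open>z\<close>.
  Otherwise some functionals \<open>f\<close> of the ball with \<open>f z\<close> tending to 1 stay away from the norming ones.
  By Banach-Alaoglu they have a weak-star cluster point, which is norming at \<open>z\<close>, and the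
  Kadec-Klee property turns weak-star clustering into norm clustering.
\<close>

lemma Kadec_Klee_near_face:
  fixes z :: "'a::real_normed_vector"
  assumes KK: "dual_Kadec_Klee_on_filters TYPE('a) TYPE('a \<Rightarrow>\<^sub>L real)"
    and z: "norm z = 1" and e: "e > 0"
  shows "\<exists>\<delta>>0. \<forall>f :: 'a \<Rightarrow>\<^sub>L real. norm f \<le> 1 \<and> blinfun_apply f z > 1 - \<delta> \<longrightarrow>
    (\<exists>g. norm g \<le> 1 \<and> blinfun_apply g z = 1 \<and> norm (f - g) < e)"
proof (rule ccontr)
  assume neg: "\<not> ?thesis"
  define A :: "('a \<Rightarrow>\<^sub>L real) set" where "A = {f. norm f \<le> 1 \<and>
    \<not> (\<exists>g. norm g \<le> 1 \<and> blinfun_apply g z = 1 \<and> norm (f - g) < e)}"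
  have ex: "\<exists>f\<in>A. blinfun_apply f z > 1 - \<delta>" if "\<delta> > 0" for \<delta>
    using neg that unfolding A_def by blast
  define F where "F = inf (filtercomap (\<lambda>f. blinfun_apply f z) (nhds 1)) (principal A)"
  have evA: "eventually (\<lambda>f. f \<in> A) F" unfolding F_def by (simp add: eventually_inf_principal)
  have "F \<noteq> bot"
  proof
    assume "F = bot"
    then have "eventually (\<lambda>f. f \<notin> A) (filtercomap (\<lambda>f. blinfun_apply f z) (nhds 1))"
      unfolding F_def trivial_limit_def eventually_inf_principal by simp
    then obtain P where P: "eventually P (nhds 1)" "\<And>f. P (blinfun_apply f z) \<Longrightarrow> f \<notin> A"
      by (auto simp: eventually_filtercomap)
    then obtain \<delta> where "\<delta> > 0" "\<And>t. dist t 1 < \<delta> \<Longrightarrow> P t" by (auto simp: eventually_nhds_metric)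
    moreover obtain f where "f \<in> A" "blinfun_apply f z > 1 - \<delta>" using ex[OF \<open>\<delta> > 0\<close>] by blast
    moreover have "blinfun_apply f z \<le> 1"
      using \<open>f \<in> A\<close> norm_blinfun[of f z] z by (auto simp: A_def)
    ultimately show False using P(2)[of f] by (simp add: dist_real_def)
  qed
  \<comment> \<open>As functions on \<open>'a\<close>, the functionals in the ball lie in a product of compact intervals.\<close>
  define K where "K = (\<Pi>\<^sub>E x\<in>UNIV. cball (0::real) (norm (x::'a)))"
  have "compact K"
    unfolding K_def compactin_euclidean_iff[symmetric] euclidean_product_topology[symmetric]
    by (simp add: compactin_PiE)
  moreover have "eventually (\<lambda>h. h \<in> K) (filtermap blinfun_apply F)"
  proof -
    have "blinfun_apply f \<in> K" if "f \<in> A" for f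
    proof -
      have "norm (blinfun_apply f x) \<le> norm x" for x
        using norm_blinfun[of f x] that mult_right_mono[of "norm f" 1 "norm x"]
        by (simp add: A_def)
      then show ?thesis by (auto simp: K_def PiE_UNIV_domain)
    qed
    then show ?thesis
      unfolding eventually_filtermap using evA by (simp add: eventually_mono)
  qed
  ultimately obtain g where g: "g \<in> K" "inf (nhds g) (filtermap blinfun_apply F) \<noteq> bot"
    using \<open>F \<noteq> bot\<close> unfolding compact_filter by (metis filtermap_bot_iff)
  \<comment> \<open>The trace of \<open>F\<close> on the neighbourhoods of the cluster point converges to it pointwise.\<close>
  define F' where "F' = inf F (filtercomap blinfun_apply (nhds g))"
  have F': "F' \<noteq> bot"
  proof
    assume "F' = bot"
    then have "eventually (\<lambda>_. False) F'" by simp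
    then obtain P Q where PQ: "eventually P F" "eventually Q (nhds g)"
      "\<And>f. P f \<Longrightarrow> Q (blinfun_apply f) \<Longrightarrow> False"
      unfolding F'_def eventually_inf eventually_filtercomap by metis
    have "eventually (\<lambda>h. \<not> Q h) (filtermap blinfun_apply F)"
      unfolding eventually_filtermap using PQ(1) by (rule eventually_mono) (use PQ(3) in blast)
    with PQ(2) have "eventually (\<lambda>_. False) (inf (nhds g) (filtermap blinfun_apply F))"
      unfolding eventually_inf by blast
    with g(2) show False by (simp add: trivial_limit_def)
  qed
  have "(blinfun_apply \<longlongrightarrow> g) F'"
    unfolding F'_def filterlim_def filtermap_le_iff_le_filtercomap by simp
  then have lim: "((\<lambda>f. blinfun_apply f x) \<longlongrightarrow> g x) F'" for x
    by (rule continuous_on_tendsto_compose[OF continuous_on_product_coordinates]) auto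
  have "linear g"
  proof (rule linearI)
    fix x y and r :: real
    have "((\<lambda>f. blinfun_apply f (x + y)) \<longlongrightarrow> g x + g y) F'"
      unfolding blinfun.add_right by (intro tendsto_add lim)
    then show "g (x + y) = g x + g y" using lim tendsto_unique[OF F'] by blast
    have "((\<lambda>f. blinfun_apply f (r *\<^sub>R x)) \<longlongrightarrow> r *\<^sub>R g x) F'"
      unfolding blinfun.scaleR_right by (intro tendsto_scaleR tendsto_const lim)
    then show "g (r *\<^sub>R x) = r *\<^sub>R g x" using lim tendsto_unique[OF F'] by blast
  qed
  moreover have g_le: "\<bar>g x\<bar> \<le> norm x" for x using g(1) by (simp add: K_def PiE_def Pi_def)
  ultimately have bl: "bounded_linear g"
    by (intro bounded_linear_intro[where K=1]) (auto simp: linear_add linear_cmul)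
  define G where "G = Blinfun g"
  have G: "blinfun_apply G = g" unfolding G_def by (rule bounded_linear_Blinfun_apply[OF bl])
  have "((\<lambda>f. blinfun_apply f z) \<longlongrightarrow> 1) F'"
    unfolding F'_def F_def filterlim_def filtermap_le_iff_le_filtercomap by (simp add: le_infI1)
  then have Gz: "blinfun_apply G z = 1" using lim[of z] tendsto_unique[OF F'] G by metis
  have "norm G \<le> 1" by (rule norm_blinfun_bound) (use g_le in \<open>simp_all add: G\<close>)
  moreover have "norm G \<ge> 1" using norm_blinfun[of G z] Gz z by simp
  ultimately have nG: "norm G = 1" by simp
  have evA': "eventually (\<lambda>f. f \<in> A) F'"
    using evA by (rule filter_leD[rotated]) (simp add: F'_def)
  have "((\<lambda>f. norm (f - G)) \<longlongrightarrow> 0) F'"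
  proof -
    have "eventually (\<lambda>f. norm f \<le> 1) F'" using evA' by (rule eventually_mono) (simp add: A_def)
    then show ?thesis
      using KK[unfolded dual_Kadec_Klee_on_filters_def, rule_format, of "\<lambda>f. f" F' G] nG lim G by simp
  qed
  then have "eventually (\<lambda>f. norm (f - G) < e) F'" using e by (simp add: order_tendstoD)
  with evA' have "eventually (\<lambda>_. False) F'"
    by eventually_elim (use nG Gz in \<open>auto simp: A_def\<close>)
  with F' show False by simp
qed

text \<open>
  The derivative at \<open>z\<close> in the direction \<open>h\<close> is the supremum of \<open>g h\<close> over the norming functionals
  \<open>g\<close> at \<open>z\<close>. It bounds the difference quotient from below. From above the quotient is at most
  \<open>f h\<close>, where \<open>f\<close> is norming at \<open>z + t *\<^sub>R h\<close>. As \<open>f z \<ge> 1 - 2 * t\<close> for every unit vector \<open>h\<close>, the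
  functional \<open>f\<close> is close to a norming one at \<open>z\<close>, at a distance that does not depend on \<open>h\<close>.
\<close>

lemma Kadec_Klee_imp_SSD:
  assumes KK: "dual_Kadec_Klee_on_filters TYPE('a::real_normed_vector) TYPE('a \<Rightarrow>\<^sub>L real)"
  shows "SSD_norm TYPE('a)"
  unfolding SSD_norm_def SSD_at_def
proof (intro allI impI exI)
  fix z :: 'a assume "z \<in> sphere 0 1"
  then have z: "norm z = 1" by simp
  define J where "J = {g :: 'a \<Rightarrow>\<^sub>L real. norm g \<le> 1 \<and> blinfun_apply g z = 1}"
  define d where "d = (\<lambda>h. SUP g\<in>J. blinfun_apply g h)"
  have le: "blinfun_apply g x \<le> norm x" if "norm g \<le> 1" for g :: "'a \<Rightarrow>\<^sub>L real" and x
    using norm_blinfun[of g x] that mult_right_mono[of "norm g" 1 "norm x"] by simp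
  have "J \<noteq> {}" using norming_functional[of z] z unfolding J_def by (metis (mono_tags) empty_iff mem_Collect_eq)
  have up: "blinfun_apply g h \<le> d h" if "g \<in> J" for g h
    unfolding d_def using that
    by (intro cSUP_upper bdd_aboveI2[where M="norm h"]) (auto simp: J_def le)
  show "uniform_limit (sphere 0 1) (\<lambda>t h. (norm (z + t *\<^sub>R h) - 1) / t) d (at_right 0)"
    unfolding uniform_limit_iff
  proof (intro allI impI)
    fix e :: real assume e: "e > 0"
    obtain \<delta> where \<delta>: "\<delta> > 0" "\<And>f :: 'a \<Rightarrow>\<^sub>L real. norm f \<le> 1 \<Longrightarrow> blinfun_apply f z > 1 - \<delta> \<Longrightarrow>
        \<exists>g. norm g \<le> 1 \<and> blinfun_apply g z = 1 \<and> norm (f - g) < e"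
      using Kadec_Klee_near_face[OF KK z e] by blast
    have key: "dist ((norm (z + t *\<^sub>R h) - 1) / t) (d h) < e"
      if t: "0 < t" "t < \<delta> / 2" and h: "norm h = 1" for t h
    proof -
      obtain f :: "'a \<Rightarrow>\<^sub>L real" where f: "norm f \<le> 1" "blinfun_apply f (z + t *\<^sub>R h) = norm (z + t *\<^sub>R h)"
        by (rule norming_functional)
      have fh: "blinfun_apply f z + t * blinfun_apply f h = norm (z + t *\<^sub>R h)"
        using f(2) by (simp add: blinfun.add_right blinfun.scaleR_right)
      have "1 - t \<le> norm (z + t *\<^sub>R h)"
        using norm_diff_ineq[of z "t *\<^sub>R h"] z h t by simp
      moreover have "t * blinfun_apply f h \<le> t" using le[OF f(1), of h] h t by simp
      ultimately have "blinfun_apply f z > 1 - \<delta>" using fh t by linarith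
      then obtain g where g: "g \<in> J" "norm (f - g) < e" using \<delta>(2) f(1) by (auto simp: J_def)
      have "t * blinfun_apply f h \<ge> norm (z + t *\<^sub>R h) - 1" using fh le[OF f(1), of z] z by simp
      then have "(norm (z + t *\<^sub>R h) - 1) / t \<le> blinfun_apply f h" using t by (simp add: field_simps)
      also have "\<dots> = blinfun_apply g h + blinfun_apply (f - g) h" by (simp add: blinfun.diff_left)
      also have "\<dots> < d h + e"
        using up[OF g(1), of h] norm_blinfun[of "f - g" h] g(2) h by simp
      finally have "(norm (z + t *\<^sub>R h) - 1) / t < d h + e" .
      moreover have "d h \<le> (norm (z + t *\<^sub>R h) - 1) / t"
        unfolding d_def
      proof (rule cSUP_least[OF \<open>J \<noteq> {}\<close>])
        fix g assume "g \<in> J"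
        then have "1 + t * blinfun_apply g h \<le> norm (z + t *\<^sub>R h)"
          using le[of g "z + t *\<^sub>R h"] by (simp add: J_def blinfun.add_right blinfun.scaleR_right)
        then show "blinfun_apply g h \<le> (norm (z + t *\<^sub>R h) - 1) / t" using t by (simp add: field_simps)
      qed
      ultimately show ?thesis by (simp add: dist_real_def)
    qed
    show "\<forall>\<^sub>F t in at_right 0. \<forall>h\<in>sphere 0 1. dist ((norm (z + t *\<^sub>R h) - 1) / t) (d h) < e"
      unfolding eventually_at_right_field using \<delta>(1) key by (intro exI[of _ "\<delta> / 2"]) simp
  qed
qed

section \<open>Restrictions of null families\<close>

definition c0_restrict :: "'i set \<Rightarrow> 'i c0 \<Rightarrow> 'i c0" where
  "c0_restrict A a = Abs_c0 (\<lambda>i. if i \<in> A then c0_apply a i else 0)"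

definition c0_unit :: "'i \<Rightarrow> 'i c0" where
  "c0_unit i = Abs_c0 (\<lambda>j. if j = i then 1 else 0)"

lemma c0_apply_restrict [simp]:
  "c0_apply (c0_restrict A a) i = (if i \<in> A then c0_apply a i else 0)"
proof -
  have "finite {i. \<bar>if i \<in> A then c0_apply a i else 0\<bar> > e}" if "e > 0" for e
    by (rule finite_subset[OF _ c0_apply_finite[OF that, of a]]) (use that in auto)
  then show ?thesis unfolding c0_restrict_def by (subst Abs_c0_inverse) auto
qed

lemma c0_apply_unit [simp]: "c0_apply (c0_unit i) j = (if j = i then 1 else 0)"
proof -
  have "finite {j. \<bar>if j = i then 1 else 0 :: real\<bar> > e}" if "e > 0" for e
    by (rule finite_subset[of _ "{i}"]) (use that in auto)
  then show ?thesis unfolding c0_unit_def by (subst Abs_c0_inverse) auto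
qed

lemma c0_restrict_finite:
  assumes "finite A"
  shows "c0_restrict A a = (\<Sum>i\<in>A. c0_apply a i *\<^sub>R c0_unit i)"
  using assms
proof (induction A rule: finite_induct)
  case empty
  show ?case by (rule c0_eqI) simp
next
  case (insert j A)
  have "c0_restrict (insert j A) a = c0_apply a j *\<^sub>R c0_unit j + c0_restrict A a"
    using insert.hyps by (intro c0_eqI) auto
  with insert show ?case by simp
qed

lemma c0_add_restrict_Compl: "c0_restrict A a + c0_restrict (- A) a = a"
  by (rule c0_eqI) simp

text \<open>
  In the supremum norm, disjointly supported vectors do not accumulate: the norm of the sum is the
  larger of the two norms.
\<close>

lemma c0_norm_add_disjoint_le:
  assumes "norm a \<le> C" and "norm b \<le> C"
  shows "norm (c0_restrict A a + c0_restrict (- A) b) \<le> C"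
  using c0_apply_le_norm[of a] c0_apply_le_norm[of b] assms
  by (intro c0_norm_le) (auto intro: order_trans)

lemma c0_restrict_approx:
  assumes "e > 0"
  obtains A where "finite A" and "norm (a - c0_restrict A a) \<le> e"
  by (rule that[OF c0_apply_finite[OF assms, of a]])
    (rule c0_norm_le, use assms in auto)

section \<open>Elementary tensors and the norm of a functional\<close>

definition elem_tensor ::
    "'a::real_normed_vector \<Rightarrow> 'b::real_normed_vector \<Rightarrow> ('a, 'b) proj_tensor" where
  "elem_tensor x y = completion_embed (tensor x y)"

lemma elem_tensor_simps:
  "elem_tensor (a + b) y = elem_tensor a y + elem_tensor b y"
  "elem_tensor (a - b) y = elem_tensor a y - elem_tensor b y"
  "elem_tensor (- a) y = - elem_tensor a y"
  "elem_tensor (r *\<^sub>R a) y = r *\<^sub>R elem_tensor a y"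
  "elem_tensor a (y + z) = elem_tensor a y + elem_tensor a z"
  "elem_tensor a (y - z) = elem_tensor a y - elem_tensor a z"
  "elem_tensor a (r *\<^sub>R y) = r *\<^sub>R elem_tensor a y"
  "elem_tensor 0 y = 0"
  unfolding elem_tensor_def
  by (simp_all add: bilinear_ladd[OF bilinear_tensor] bilinear_radd[OF bilinear_tensor]
      bilinear_lsub[OF bilinear_tensor] bilinear_rsub[OF bilinear_tensor]
      bilinear_lmul[OF bilinear_tensor] bilinear_rmul[OF bilinear_tensor]
      bilinear_lneg[OF bilinear_tensor] bilinear_lzero[OF bilinear_tensor]
      linear_add[OF linear_completion_embed] linear_diff[OF linear_completion_embed]
      linear_neg[OF linear_completion_embed] linear_cmul[OF linear_completion_embed]
      linear_0[OF linear_completion_embed])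

lemma elem_tensor_sum:
  "elem_tensor (\<Sum>i\<in>A. r i *\<^sub>R u i) y = (\<Sum>i\<in>A. r i *\<^sub>R elem_tensor (u i) y)"
  by (induction A rule: infinite_finite_induct) (simp_all add: elem_tensor_simps)

lemma norm_elem_tensor_le: "norm (elem_tensor x y) \<le> norm x * norm y"
  unfolding elem_tensor_def norm_completion_embed
  using tensor_norm_le[of "tensor x y" "[(x, y)]"] by simp

lemma elem_tensor_apply_le:
  fixes R :: "('a::real_normed_vector, 'b::real_normed_vector) proj_tensor \<Rightarrow>\<^sub>L real"
  shows "\<bar>blinfun_apply R (elem_tensor a y)\<bar> \<le> norm R * norm a * norm y"
  using norm_blinfun[of R "elem_tensor a y"] mult_left_mono[OF norm_elem_tensor_le[of a y], of "norm R"]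
  by (simp add: mult.assoc)

text \<open>
  The inequality needed for the isometric identification of the dual of the projective tensor product
  with a space of bilinear forms: a bound on elementary tensors of the unit balls passes to finite
  sums by the definition of the norm as an infimum over representations, and to the completion by
  density.
\<close>

lemma norm_le_on_elem_tensors:
  fixes R :: "('a::real_normed_vector, 'b::real_normed_vector) proj_tensor \<Rightarrow>\<^sub>L real"
  assumes C: "C > 0"
    and le: "\<And>a y. norm a \<le> 1 \<Longrightarrow> norm y \<le> 1 \<Longrightarrow> blinfun_apply R (elem_tensor a y) \<le> C"
  shows "norm R \<le> C"
proof -
  have le': "blinfun_apply R (elem_tensor a y) \<le> C * (norm a * norm y)" for a y
  proof (cases "a = 0 \<or> y = 0")
    case True
    then have "norm (elem_tensor a y) \<le> 0" using norm_elem_tensor_le[of a y] by auto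
    then show ?thesis using True by (auto simp: blinfun.zero_right)
  next
    case False
    have "blinfun_apply R (elem_tensor (inverse (norm a) *\<^sub>R a) (inverse (norm y) *\<^sub>R y)) \<le> C"
      using False by (intro le) auto
    then show ?thesis
      using False by (simp add: elem_tensor_simps blinfun.scaleR_right field_simps)
  qed
  have abs_le: "\<bar>blinfun_apply R (elem_tensor a y)\<bar> \<le> C * (norm a * norm y)" for a y
    using le'[of a y] le'[of "- a" y] by (simp add: elem_tensor_simps blinfun.minus_right abs_le_iff)
  have emb: "\<bar>blinfun_apply R (completion_embed u)\<bar> \<le> C * norm u" for u
  proof -
    have "\<bar>blinfun_apply R (completion_embed u)\<bar> / C \<le> norm u"
    proof (rule tensor_norm_greatest)
      fix zs assume u: "u = (\<Sum>(x, y)\<leftarrow>zs. tensor x y)"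
      have "\<bar>blinfun_apply R (completion_embed (\<Sum>(x, y)\<leftarrow>zs. tensor x y))\<bar> \<le> C * (\<Sum>(x, y)\<leftarrow>zs. norm x * norm y)"
      proof (induction zs)
        case Nil
        then show ?case by (simp add: linear_0[OF linear_completion_embed] blinfun.zero_right)
      next
        case (Cons z zs)
        obtain x y where [simp]: "z = (x, y)" by (cases z)
        show ?case
          using Cons abs_le[of x y]
          by (simp add: linear_add[OF linear_completion_embed] blinfun.add_right
              elem_tensor_def[symmetric] distrib_left)
      qed
      then show "\<bar>blinfun_apply R (completion_embed u)\<bar> / C \<le> (\<Sum>(x, y)\<leftarrow>zs. norm x * norm y)"
        using C by (simp add: u field_simps)
    qed
    then show ?thesis using C by (simp add: field_simps)
  qed
  show ?thesis
  proof (rule norm_blinfun_bound)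
    fix w :: "('a, 'b) proj_tensor"
    obtain X where X: "Cauchy X" "w = abs_completion X" by (rule completion_obtain_Cauchy)
    have "(\<lambda>n. norm (blinfun_apply R (completion_embed (X n)))) \<longlonglongrightarrow> norm (blinfun_apply R w)"
      unfolding X(2) by (intro tendsto_intros completion_embed_tendsto X(1))
    moreover have "(\<lambda>n. C * norm (X n)) \<longlonglongrightarrow> C * norm w"
      unfolding X(2) by (intro tendsto_intros completion_norm_tendsto X(1))
    ultimately show "norm (blinfun_apply R w) \<le> C * norm w"
      by (rule LIMSEQ_le) (use emb in auto)
  qed (use C in simp)
qed

section \<open>The Kadec-Klee property of the dual\<close>

text \<open>
  The derivatives in the directions \<open>h\<close> and \<open>- h\<close> cancel, so the sum of the two difference
  quotients tends to 0.
\<close>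

lemma Gateaux_norm_symmetric_quotient:
  fixes y :: "'y::real_normed_vector"
  assumes "smooth_space TYPE('y)" and y: "norm y = 1" and e: "e > 0"
  shows "\<exists>t>0. norm (y + t *\<^sub>R h) + norm (y - t *\<^sub>R h) \<le> 2 + e * t"
proof -
  have "gateaux_differentiable_at norm y" using assms(1) y by (simp add: smooth_space_def)
  then obtain f' where f': "bounded_linear f'"
    "\<And>h. ((\<lambda>t. (norm (y + t *\<^sub>R h) - norm y) / t) \<longlongrightarrow> f' h) (at 0)"
    unfolding gateaux_differentiable_at_def by blast
  have "((\<lambda>t. (norm (y + t *\<^sub>R h) - norm y) / t + (norm (y + t *\<^sub>R (- h)) - norm y) / t)
      \<longlongrightarrow> f' h + f' (- h)) (at_right 0)"
    by (rule tendsto_mono[OF at_le[of "{0<..}" UNIV 0]]) (simp, intro tendsto_add f'(2))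
  moreover have "f' h + f' (- h) = 0" by (simp add: linear_neg[OF bounded_linear.linear[OF f'(1)]])
  ultimately have "\<forall>\<^sub>F t in at_right 0.
      (norm (y + t *\<^sub>R h) - norm y) / t + (norm (y + t *\<^sub>R (- h)) - norm y) / t < e"
    using e by (auto dest: order_tendstoD(2))
  then obtain b where b: "b > 0" "\<And>t. 0 < t \<Longrightarrow> t < b \<Longrightarrow>
      (norm (y + t *\<^sub>R h) - norm y) / t + (norm (y + t *\<^sub>R (- h)) - norm y) / t < e"
    by (auto simp: eventually_at_right_field)
  define t where "t = b / 2"
  have t: "t > 0" "t < b" using b(1) by (simp_all add: t_def)
  with b(2)[OF t] y have "norm (y + t *\<^sub>R h) + norm (y - t *\<^sub>R h) - 2 < e * t"
    by (simp add: pos_divide_less_eq flip: add_divide_distrib)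
  then show ?thesis using t(1) by (intro exI[of _ t]) simp
qed

text \<open>
  If \<open>R\<close>, in the unit ball, is close to 1 at \<open>u \<otimes> y\<close> and \<open>v\<close> is disjoint from \<open>u\<close>, then \<open>R (v \<otimes> h)\<close> is
  small, uniformly in \<open>R\<close>, \<open>u\<close> and \<open>v\<close>. Indeed \<open>u + v\<close> and \<open>u - v\<close> are both in the unit ball, so
  \<open>R ((u + v) \<otimes> (y + t h)) + R ((u - v) \<otimes> (y - t h)) \<le> \<parallel>y + t h\<parallel> + \<parallel>y - t h\<parallel>\<close>. The left-hand
  side is \<open>2 R (u \<otimes> y) + 2 t R (v \<otimes> h)\<close>, and by smoothness the right-hand side is at most
  \<open>2 + e t\<close> for a suitable \<open>t\<close>. This replaces the uniform convexity of the dual of the second factor.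
\<close>

lemma disjoint_tail_small:
  fixes y :: "'y::real_normed_vector"
  assumes "smooth_space TYPE('y)" and y: "norm y = 1" and e: "e > 0"
  shows "\<exists>\<delta>>0. \<forall>(R :: ('i c0, 'y) proj_tensor \<Rightarrow>\<^sub>L real) A a b.
    norm R \<le> 1 \<and> norm a \<le> 1 \<and> norm b \<le> 1 \<and>
    blinfun_apply R (elem_tensor (c0_restrict A a) y) \<ge> 1 - \<delta> \<longrightarrow>
    \<bar>blinfun_apply R (elem_tensor (c0_restrict (- A) b) h)\<bar> \<le> e"
proof -
  obtain t where t: "t > 0" "norm (y + t *\<^sub>R h) + norm (y - t *\<^sub>R h) \<le> 2 + e * t"
    using Gateaux_norm_symmetric_quotient[OF assms] by blast
  have half: "blinfun_apply R (elem_tensor (c0_restrict (- A) b) h) \<le> e"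
    if R: "norm R \<le> 1" and ab: "norm a \<le> 1" "norm b \<le> 1"
      and big: "blinfun_apply R (elem_tensor (c0_restrict A a) y) \<ge> 1 - e * t / 2"
    for R :: "('i c0, 'y) proj_tensor \<Rightarrow>\<^sub>L real" and A a b
  proof -
    define u v where "u = c0_restrict A a" and "v = c0_restrict (- A) b"
    have bound: "blinfun_apply R (elem_tensor c x) \<le> norm x" if "norm c \<le> 1" for c x
    proof -
      have "norm R * norm c \<le> 1" using R that by (simp add: mult_le_one)
      then show ?thesis
        using elem_tensor_apply_le[of R c x] mult_right_mono[of "norm R * norm c" 1 "norm x"] by simp
    qed
    have "norm (u + v) \<le> 1" unfolding u_def v_def by (intro c0_norm_add_disjoint_le ab)
    then have "blinfun_apply R (elem_tensor (u + v) (y + t *\<^sub>R h)) \<le> norm (y + t *\<^sub>R h)" by (rule bound)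
    moreover have "u - v = c0_restrict A a + c0_restrict (- A) (- b)"
      unfolding u_def v_def by (rule c0_eqI) simp
    then have "norm (u - v) \<le> 1" using ab by (simp add: c0_norm_add_disjoint_le)
    then have "blinfun_apply R (elem_tensor (u - v) (y - t *\<^sub>R h)) \<le> norm (y - t *\<^sub>R h)" by (rule bound)
    ultimately have "2 * blinfun_apply R (elem_tensor u y) + 2 * (t * blinfun_apply R (elem_tensor v h)) \<le> 2 + e * t"
      using t(2) by (simp add: elem_tensor_simps blinfun.add_right blinfun.diff_right
          blinfun.scaleR_right right_diff_distrib distrib_left)
    with big have "t * blinfun_apply R (elem_tensor v h) \<le> t * e" by (simp add: u_def mult.commute)
    then show ?thesis using t(1) by (simp add: v_def)
  qed
  have neg: "c0_restrict A (- b) = - c0_restrict A b" for A and b :: "'i c0" by (rule c0_eqI) simp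
  have "\<bar>blinfun_apply R (elem_tensor (c0_restrict (- A) b) h)\<bar> \<le> e"
    if "norm R \<le> 1" "norm a \<le> 1" "norm b \<le> 1"
      "blinfun_apply R (elem_tensor (c0_restrict A a) y) \<ge> 1 - e * t / 2"
    for R :: "('i c0, 'y) proj_tensor \<Rightarrow>\<^sub>L real" and A a b
    using half[OF that] half[of R a "- b" A] that
    by (simp add: neg elem_tensor_simps blinfun.minus_right abs_le_iff)
  moreover have "e * t / 2 > 0" using e t(1) by simp
  ultimately show ?thesis by blast
qed

text \<open>
  Since only the second factor has a compact ball, the norm need not be attained at an elementary
  tensor, but a limit \<open>y\<close> of the second components of a maximizing sequence can be kept fixed. Fixing
  \<open>y\<close> is what allows smoothness to be used at a single point, without uniformity.
\<close>

lemma norm_attained_in_second_factor: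
  fixes g :: "('a::real_normed_vector, 'y::real_normed_vector) proj_tensor \<Rightarrow>\<^sub>L real"
  assumes cpt: "compact (cball (0 :: 'y) 1)" and g: "norm g = 1"
  obtains y where "norm y = 1"
    and "\<And>\<delta>. \<delta> > 0 \<Longrightarrow> \<exists>a. norm a \<le> 1 \<and> blinfun_apply g (elem_tensor a y) > 1 - \<delta>"
proof -
  have "\<exists>a y. norm a \<le> 1 \<and> norm y \<le> 1 \<and> blinfun_apply g (elem_tensor a y) > 1 - inverse (real (Suc (Suc n)))"
    for n
  proof (rule ccontr)
    assume "\<not> ?thesis"
    \<comment> \<open>The double successor keeps the bound positive.\<close>
    then have "norm g \<le> 1 - inverse (real (Suc (Suc n)))"
      by (intro norm_le_on_elem_tensors) (auto simp: not_less field_simps)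
    with g show False by (simp add: field_simps)
  qed
  then obtain a z where az: "\<And>n. norm (a n) \<le> 1" "\<And>n. norm (z n) \<le> 1"
    "\<And>n. blinfun_apply g (elem_tensor (a n) (z n)) > 1 - inverse (real (Suc (Suc n)))" by metis
  obtain y r where y: "norm y \<le> 1" and r: "strict_mono r" "(z \<circ> r) \<longlonglongrightarrow> y"
    using cpt[unfolded compact_def, rule_format, of z] az(2) by auto
  have sup: "\<exists>a. norm a \<le> 1 \<and> blinfun_apply g (elem_tensor a y) > 1 - \<delta>" if "\<delta> > 0" for \<delta>
  proof -
    have "\<forall>\<^sub>F n in sequentially. norm (z (r n) - y) < \<delta> / 2"
      using tendstoD[OF r(2), of "\<delta> / 2"] that by (simp add: dist_norm)
    moreover have "\<forall>\<^sub>F n in sequentially. inverse (real (Suc n)) < \<delta> / 2"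
      by (rule order_tendstoD(2)[OF LIMSEQ_inverse_real_of_nat]) (use that in simp)
    ultimately have "\<forall>\<^sub>F n in sequentially. norm (z (r n) - y) < \<delta> / 2 \<and> inverse (real (Suc n)) < \<delta> / 2"
      by (rule eventually_conj)
    then obtain n where n: "norm (z (r n) - y) < \<delta> / 2" "inverse (real (Suc n)) < \<delta> / 2"
      using eventually_happens'[OF sequentially_bot] by blast
    have "\<bar>blinfun_apply g (elem_tensor (a (r n)) (z (r n) - y))\<bar> \<le> norm (z (r n) - y)"
      using elem_tensor_apply_le[of g "a (r n)" "z (r n) - y"] g
        mult_right_mono[OF az(1), of "norm (z (r n) - y)" "r n"] by simp
    moreover have "inverse (real (Suc (Suc (r n)))) \<le> inverse (real (Suc n))"
      using seq_suble[OF r(1), of n] by (simp add: field_simps)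
    moreover have "blinfun_apply g (elem_tensor (a (r n)) y) = blinfun_apply g (elem_tensor (a (r n)) (z (r n)))
        - blinfun_apply g (elem_tensor (a (r n)) (z (r n) - y))"
      by (simp add: elem_tensor_simps blinfun.diff_right)
    ultimately have "blinfun_apply g (elem_tensor (a (r n)) y) > 1 - \<delta>"
      using n az(3)[of "r n"] by linarith
    with az(1) show ?thesis by blast
  qed
  have "norm y \<ge> 1"
  proof (rule ccontr)
    assume "\<not> norm y \<ge> 1"
    then obtain a where a: "norm a \<le> 1" "blinfun_apply g (elem_tensor a y) > 1 - (1 - norm y)"
      using sup[of "1 - norm y"] by auto
    have "\<bar>blinfun_apply g (elem_tensor a y)\<bar> \<le> norm y"
      using elem_tensor_apply_le[of g a y] g mult_right_mono[OF a(1), of "norm y"] by simp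
    with a show False by simp
  qed
  with y have "norm y = 1" by simp
  then show ?thesis using sup by (rule that)
qed

text \<open>
  A finite set \<open>A\<close> of coordinates on which \<open>g\<close> almost attains its norm is found first. By weak-star
  convergence almost all \<open>f s\<close> almost attain the bound 1 on the same \<open>A\<close>, so the tails off \<open>A\<close> of \<open>f s\<close>
  and \<open>g\<close> are small. On \<open>A\<close> only finitely many values \<open>f s (c0_unit i \<otimes> h)\<close> have to converge.
\<close>

lemma eventually_close_at_fixed_vector:
  fixes f :: "'s \<Rightarrow> ('i c0, 'y::real_normed_vector) proj_tensor \<Rightarrow>\<^sub>L real"
  assumes smooth: "smooth_space TYPE('y)" and y: "norm y = 1"
    and attained: "\<And>\<delta>. \<delta> > 0 \<Longrightarrow> \<exists>a. norm a \<le> 1 \<and> blinfun_apply g (elem_tensor a y) > 1 - \<delta>"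
    and f: "\<forall>\<^sub>F s in F. norm (f s) \<le> 1" and g: "norm g = 1"
    and lim: "\<And>x. ((\<lambda>s. blinfun_apply (f s) x) \<longlongrightarrow> blinfun_apply g x) F"
    and e: "e > 0"
  shows "\<forall>\<^sub>F s in F. \<forall>c. norm c \<le> 1 \<longrightarrow> \<bar>blinfun_apply (f s - g) (elem_tensor c h)\<bar> \<le> e"
proof -
  have "e / 3 > 0" using e by simp
  from disjoint_tail_small[OF smooth y this, of h] obtain \<delta> where \<delta>: "\<delta> > 0"
    and tail: "\<And>(R :: ('i c0, 'y) proj_tensor \<Rightarrow>\<^sub>L real) A a b.
      norm R \<le> 1 \<Longrightarrow> norm a \<le> 1 \<Longrightarrow> norm b \<le> 1 \<Longrightarrow>
      blinfun_apply R (elem_tensor (c0_restrict A a) y) \<ge> 1 - \<delta> \<Longrightarrow>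
      \<bar>blinfun_apply R (elem_tensor (c0_restrict (- A) b) h)\<bar> \<le> e / 3" by blast
  obtain a where a: "norm a \<le> 1" "blinfun_apply g (elem_tensor a y) > 1 - \<delta> / 2"
    using attained[of "\<delta> / 2"] \<delta> by auto
  obtain A where A: "finite A" "norm (a - c0_restrict A a) \<le> \<delta> / 2"
    using c0_restrict_approx[of "\<delta> / 2" a] \<delta> by auto
  have "\<bar>blinfun_apply g (elem_tensor (a - c0_restrict A a) y)\<bar> \<le> \<delta> / 2"
    using elem_tensor_apply_le[of g "a - c0_restrict A a" y] g y A(2) by simp
  then have gA: "blinfun_apply g (elem_tensor (c0_restrict A a) y) > 1 - \<delta>"
    using a(2) unfolding elem_tensor_simps blinfun.diff_right by linarith
  then have fA: "\<forall>\<^sub>F s in F. blinfun_apply (f s) (elem_tensor (c0_restrict A a) y) > 1 - \<delta>"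
    by (rule order_tendstoD(1)[OF lim])
  have "((\<lambda>s. \<Sum>i\<in>A. \<bar>blinfun_apply (f s - g) (elem_tensor (c0_unit i) h)\<bar>) \<longlongrightarrow> (\<Sum>i\<in>A. 0)) F"
    unfolding blinfun.diff_left
    by (intro tendsto_sum tendsto_rabs_zero LIM_zero lim)
  then have heads: "\<forall>\<^sub>F s in F. (\<Sum>i\<in>A. \<bar>blinfun_apply (f s - g) (elem_tensor (c0_unit i) h)\<bar>) < e / 3"
    using e by (intro order_tendstoD(2)) auto
  from f fA heads show ?thesis
  proof eventually_elim
    case (elim s)
    show ?case
    proof (intro allI impI)
      fix c :: "'i c0" assume c: "norm c \<le> 1"
      let ?D = "f s - g"
      have "\<bar>blinfun_apply ?D (elem_tensor (c0_restrict A c) h)\<bar> \<le>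
          (\<Sum>i\<in>A. \<bar>c0_apply c i * blinfun_apply ?D (elem_tensor (c0_unit i) h)\<bar>)"
        unfolding c0_restrict_finite[OF A(1)] elem_tensor_sum blinfun.sum_right blinfun.scaleR_right
        by simp
      also have "\<dots> \<le> (\<Sum>i\<in>A. \<bar>blinfun_apply ?D (elem_tensor (c0_unit i) h)\<bar>)"
        unfolding abs_mult using order_trans[OF c0_apply_le_norm c]
        by (intro sum_mono mult_left_le_one_le) auto
      also have "\<dots> < e / 3" by (rule elim)
      finally have head: "\<bar>blinfun_apply ?D (elem_tensor (c0_restrict A c) h)\<bar> < e / 3" .
      have "elem_tensor c h = elem_tensor (c0_restrict A c) h + elem_tensor (c0_restrict (- A) c) h"
        by (simp add: c0_add_restrict_Compl flip: elem_tensor_simps)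
      then have "blinfun_apply ?D (elem_tensor c h) = blinfun_apply ?D (elem_tensor (c0_restrict A c) h)
          + (blinfun_apply (f s) (elem_tensor (c0_restrict (- A) c) h)
          - blinfun_apply g (elem_tensor (c0_restrict (- A) c) h))"
        by (simp add: blinfun.add_right blinfun.diff_left)
      moreover have "\<bar>blinfun_apply (f s) (elem_tensor (c0_restrict (- A) c) h)\<bar> \<le> e / 3"
        using elim by (intro tail[OF _ a(1) c]) auto
      moreover have "\<bar>blinfun_apply g (elem_tensor (c0_restrict (- A) c) h)\<bar> \<le> e / 3"
        using g gA by (intro tail[OF _ a(1) c]) auto
      ultimately show "\<bar>blinfun_apply ?D (elem_tensor c h)\<bar> \<le> e" using head by linarith
    qed
  qed
qed

text \<open>
  The estimate for a fixed vector of the second factor is used on a finite net of its unit ball, which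
  exists by compactness. The remaining vectors are covered by the bound 2 for the norm of \<open>f s - g\<close>.
\<close>

lemma c0_tensor_dual_Kadec_Klee:
  assumes cpt: "compact (cball (0 :: 'y::real_normed_vector) 1)" and smooth: "smooth_space TYPE('y)"
  shows "dual_Kadec_Klee_on_filters TYPE(('i c0, 'y) proj_tensor) TYPE('s)"
  unfolding dual_Kadec_Klee_on_filters_def
proof (intro allI impI, elim conjE)
  fix F :: "'s filter" and f :: "'s \<Rightarrow> ('i c0, 'y) proj_tensor \<Rightarrow>\<^sub>L real" and g
  assume f: "\<forall>\<^sub>F s in F. norm (f s) \<le> 1" and g: "norm g = 1"
    and lim: "\<forall>x. ((\<lambda>s. blinfun_apply (f s) x) \<longlongrightarrow> blinfun_apply g x) F"
  obtain y where y: "norm y = 1"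
    "\<And>\<delta>. \<delta> > 0 \<Longrightarrow> \<exists>a. norm a \<le> 1 \<and> blinfun_apply g (elem_tensor a y) > 1 - \<delta>"
    using norm_attained_in_second_factor[OF cpt g] by blast
  show "((\<lambda>s. norm (f s - g)) \<longlongrightarrow> 0) F"
    unfolding tendsto_iff
  proof (intro allI impI)
    fix e :: real assume e: "e > 0"
    then have "e / 6 > 0" by simp
    then obtain N where N: "finite N" "cball (0 :: 'y) 1 \<subseteq> (\<Union>h\<in>N. ball h (e / 6))"
      using cpt unfolding compact_eq_totally_bounded by blast
    have "\<forall>\<^sub>F s in F. \<forall>h\<in>N. \<forall>c. norm c \<le> 1 \<longrightarrow> \<bar>blinfun_apply (f s - g) (elem_tensor c h)\<bar> \<le> e / 6"
      using N(1) eventually_close_at_fixed_vector[OF smooth y f g lim[rule_format] \<open>e / 6 > 0\<close>]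
      by (intro eventually_ball_finite) auto
    with f show "\<forall>\<^sub>F s in F. dist (norm (f s - g)) 0 < e"
    proof eventually_elim
      case (elim s)
      let ?D = "f s - g"
      have D: "norm ?D \<le> 2" using norm_triangle_ineq4[of "f s" g] elim(1) g by simp
      have "norm ?D \<le> e / 2"
      proof (rule norm_le_on_elem_tensors)
        fix c :: "'i c0" and x :: 'y assume c: "norm c \<le> 1" and x: "norm x \<le> 1"
        then obtain h where h: "h \<in> N" "norm (x - h) < e / 6"
          using N(2) by (auto simp: subset_iff dist_norm norm_minus_commute)
        have "norm ?D * norm c \<le> 2 * 1" using D c by (intro mult_mono) auto
        then have "\<bar>blinfun_apply ?D (elem_tensor c (x - h))\<bar> \<le> 2 * norm (x - h)"
          using elem_tensor_apply_le[of ?D c "x - h"]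
            mult_right_mono[of "norm ?D * norm c" 2 "norm (x - h)"] by simp
        moreover have "\<bar>blinfun_apply ?D (elem_tensor c h)\<bar> \<le> e / 6" using elim(2) h(1) c by blast
        moreover have "blinfun_apply ?D (elem_tensor c x) =
            blinfun_apply ?D (elem_tensor c (x - h)) + blinfun_apply ?D (elem_tensor c h)"
          by (simp add: elem_tensor_simps blinfun.diff_right)
        ultimately show "blinfun_apply ?D (elem_tensor c x) \<le> e / 2" using h(2) by linarith
      qed (use e in simp)
      then show ?case using e by (simp add: dist_real_def)
    qed
  qed
qed

theorem theorem3p7:
  assumes "infinite (UNIV :: 'i set)"
    and "finite_dimensional TYPE('y::banach)"
    and "smooth_space TYPE('y)"
  shows "SSD_norm TYPE(('i c0, 'y) proj_tensor) \<and>
    weak_star_Kadec_Klee_dual TYPE('s) TYPE(('i c0, 'y) proj_tensor)"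
  by (intro conjI Kadec_Klee_imp_SSD Kadec_Klee_on_nets
      c0_tensor_dual_Kadec_Klee[OF finite_dimensional_compact_cball[OF assms(2)] assms(3)])

end
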